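(* Let $m,d$ be positive integers, let $W$ be a finite set, and let $\Sigma=(\mathcal{K},\mathscr{L})$ be a $d$-admissible selection structure on $W$. For each $w\in W$, let $\{x^w_1,\dots,x^w_m\}\subset\mathbb{R}^{d-1}$ be an (indexed) set of $m$ points. Let $\mu_1,\dots,\mu_m$ be absolutely continuous probability measures on $\mathbb{R}^d$. Assume there does not exist a hyperplane simultaneously bisecting all measures $\mu_i$ with $i\in[m]$. For each $w\in W$, let $G_w$ be a family of hyperplanes in $\mathbb{R}^d$, closed in the standard topology of the affine Grassmannian of hyperplanes in $\mathbb{R}^d$. Suppose that for every $W'\subseteq W$ such that $W\setminus W'\notin\mathscr{L}$ and every hyperplane $H$ in $\mathbb{R}^d$, we have $H\in\bigcup_{w\in W'}G_w$. Then there exist a closed half-space $H^+$, a facet $B$ of $\mathcal{K}$ such that $H=\partial H^+\in\bigcap_{w\in B}G_w$, and a function $f:B\to[m]$ with the following properties: $$|\mu_{f(w)}(H^+)-1/2|=\max_{j\in[m]}|\mu_j(H^+)-1/2|\qquad\text{for all }w\in B.$$ Moreover, if $P_+=\{w\in B:\mu_{f(w)}(H^+)-1/2>0\}$ and $P_-=\{w\in B:\mu_{f(w)}(H^+)-1/2<0\}$, then $f(P_+)\cap f(P_-)=\emptyset$ and $$\operatorname{conv}\{x^w_{f(w)}:w\in P_+\}\cap\operatorname{conv}\{x^w_{f(w)}:w\in P_-\}\neq\emptyset.$$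
   Context: Notation: $[m]=\{1,\dots,m\}$. A facet of a simplicial complex is an inclusion-maximal face. A measure on $\mathbb{R}^d$ is absolutely continuous if it is absolutely continuous with respect to Lebesgue measure on $\mathbb{R}^d$. A hyperplane $H$ bisects $\mu$ if its two closed half-spaces $H^+,H^-$ satisfy $\mu(H^+)=\mu(H^-)$. Let $W$ be a finite set, $\mathcal{K}$ a simplicial complex on $W$, and $D=\{D_w:w\in W\}$ an indexed family of nonempty finite sets (fibers). For $U\subseteq W$, let $\mathcal{K}[U]=\{\sigma\in\mathcal{K}:\sigma\subseteq U\}$. Define $\mathcal{K}(U;D)=\bigcup_{\sigma\in\mathcal{K}[U]}\left(\ast_{w\in\sigma}D_w\right)$, where $\ast$ denotes the iterated join of the discrete sets $D_w$ (fibers of different $w$ being regarded as disjoint). Equivalently, $\mathcal{K}(U;D)$ is the simplicial complex whose faces are the sets $\{(w,y_w):w\in\sigma\}$ with $\sigma\in\mathcal{K}[U]$ and $y_w\in D_w$ for each $w\in\sigma$. For a positive integer $d$, a pair $\Sigma=(\mathcal{K},\mathscr{L})$, where $\mathcal{K}$ is a simplicial complex on $W$ and $\mathscr{L}$ is a nonempty upward-closed family of subsets of $W$, is a $d$-admissible selection structure on $W$ if: (i) for every indexed family $D=\{D_w:w\in W\}$ of nonempty finite sets and every $U\in\mathscr{L}$, the complex $\mathcal{K}(U;D)$ is $(d-1)$-connected; and (ii) for every $U\in\mathscr{L}$, the facets of $\mathcal{K}[U]$ are also facets of $\mathcal{K}$. *)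

theory Defs
  imports "HOL-Analysis.Analysis" "HOL-Probability.Probability"
begin

section \<open>Abstract simplicial complexes\<close>

text \<open>Complexes are families of faces closed under subsets; the empty face is included as soon as
  the complex is nonempty, and points of the ground set need not be vertices.\<close>

definition complex_on :: "'v set \<Rightarrow> 'v set set \<Rightarrow> bool" where
  "complex_on W K \<longleftrightarrow> K \<subseteq> Pow W \<and> (\<forall>\<sigma>\<in>K. \<forall>\<tau>. \<tau> \<subseteq> \<sigma> \<longrightarrow> \<tau> \<in> K)"

definition is_facet :: "'v set set \<Rightarrow> 'v set \<Rightarrow> bool" where
  "is_facet K B \<longleftrightarrow> B \<in> K \<and> (\<forall>\<sigma>\<in>K. B \<subseteq> \<sigma> \<longrightarrow> \<sigma> = B)"

definition induced_subcomplex :: "'v set set \<Rightarrow> 'v set \<Rightarrow> 'v set set" where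
  "induced_subcomplex K U = {\<sigma> \<in> K. \<sigma> \<subseteq> U}"

text \<open>The points of the geometric realization are given by barycentric coordinates. The product
  topology is the right one for finite complexes, the only ones to which this is applied.\<close>

definition geometric_realization :: "'v set set \<Rightarrow> ('v \<Rightarrow> real) topology" where
  "geometric_realization K = subtopology (powertop_real UNIV)
     {t. (\<forall>v. 0 \<le> t v) \<and> {v. t v \<noteq> 0} \<in> K \<and> (\<Sum>v | t v \<noteq> 0. t v) = 1}"

text \<open>A space is \<open>n\<close>-connected if it is nonempty and its homotopy groups (sets) vanish up to
  dimension \<open>n\<close>. Here \<open>nsphere i\<close> is the \<open>i\<close>-dimensional sphere, so the case \<open>i = 0\<close> is
  path-connectedness.\<close>

definition n_connected_space :: "nat \<Rightarrow> 'a topology \<Rightarrow> bool" where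
  "n_connected_space n X \<longleftrightarrow> topspace X \<noteq> {} \<and>
     (\<forall>i\<le>n. \<forall>f. continuous_map (nsphere i) X f \<longrightarrow>
        (\<exists>c. homotopic_with (\<lambda>_. True) (nsphere i) X f (\<lambda>_. c)))"

section \<open>Selection structures\<close>

text \<open>The complex \<open>K(U;D)\<close>: the union over the faces \<open>\<sigma>\<close> of \<open>K[U]\<close> of the joins of the fibers
  \<open>D w\<close>, \<open>w \<in> \<sigma>\<close>. Tagging with \<open>w\<close> makes the fibers disjoint.\<close>

definition fiber_complex :: "'w set set \<Rightarrow> 'w set \<Rightarrow> ('w \<Rightarrow> 'y set) \<Rightarrow> ('w \<times> 'y) set set" where
  "fiber_complex K U D =
     {(\<lambda>w. (w, y w)) ` \<sigma> | \<sigma> y. \<sigma> \<in> induced_subcomplex K U \<and> (\<forall>w\<in>\<sigma>. y w \<in> D w)}"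

text \<open>Since every finite set is in bijection with a set of natural numbers, it is no restriction
  to let the fibers range over the finite sets of natural numbers only.\<close>

definition admissible_selection_structure ::
  "nat \<Rightarrow> 'w set \<Rightarrow> 'w set set \<Rightarrow> 'w set set \<Rightarrow> bool" where
  "admissible_selection_structure d W K L \<longleftrightarrow>
     0 < d \<and> complex_on W K \<and>
     L \<noteq> {} \<and> L \<subseteq> Pow W \<and> (\<forall>U\<in>L. \<forall>U'. U \<subseteq> U' \<and> U' \<subseteq> W \<longrightarrow> U' \<in> L) \<and>
     (\<forall>D :: 'w \<Rightarrow> nat set. (\<forall>w\<in>W. finite (D w) \<and> D w \<noteq> {}) \<longrightarrow>
        (\<forall>U\<in>L. n_connected_space (d - 1) (geometric_realization (fiber_complex K U D)))) \<and>
     (\<forall>U\<in>L. \<forall>B. is_facet (induced_subcomplex K U) B \<longrightarrow> is_facet K B)"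

section \<open>Hyperplanes and half-spaces\<close>

definition is_hyperplane :: "'a::euclidean_space set \<Rightarrow> bool" where
  "is_hyperplane H \<longleftrightarrow> (\<exists>a b. a \<noteq> 0 \<and> H = {x. a \<bullet> x = b})"

definition is_closed_halfspace :: "'a::euclidean_space set \<Rightarrow> bool" where
  "is_closed_halfspace S \<longleftrightarrow> (\<exists>a b. a \<noteq> 0 \<and> S = {x. a \<bullet> x \<ge> b})"

definition bisects :: "'a::euclidean_space set \<Rightarrow> 'a measure \<Rightarrow> bool" where
  "bisects H \<mu> \<longleftrightarrow> (\<exists>a b. a \<noteq> 0 \<and> H = {x. a \<bullet> x = b} \<and>
     measure \<mu> {x. a \<bullet> x \<ge> b} = measure \<mu> {x. a \<bullet> x \<le> b})"

text \<open>The standard topology on the affine Grassmannian of hyperplanes is the quotient topology of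
  the parametrization by a unit normal vector and an offset, each hyperplane being hit by exactly
  two antipodal parameters.\<close>

definition hyperplane_of :: "'a::euclidean_space \<times> real \<Rightarrow> 'a set" where
  "hyperplane_of p = {x. fst p \<bullet> x = snd p}"

definition hyperplane_topology :: "'a::euclidean_space set topology" where
  "hyperplane_topology = topology (\<lambda>\<G>. \<G> \<subseteq> Collect is_hyperplane \<and>
     openin (top_of_set (sphere 0 1 \<times> UNIV)) {p \<in> sphere 0 1 \<times> UNIV. hyperplane_of p \<in> \<G>})"

lemma openin_hyperplane_topology:
  "openin hyperplane_topology \<G> \<longleftrightarrow> \<G> \<subseteq> Collect is_hyperplane \<and>
     openin (top_of_set (sphere 0 1 \<times> UNIV)) {p \<in> sphere 0 1 \<times> UNIV. hyperplane_of p \<in> \<G>}"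
proof -
  let ?T = "top_of_set (sphere (0::'a) 1 \<times> (UNIV::real set))"
  let ?pre = "\<lambda>\<G>. {p \<in> sphere (0::'a) 1 \<times> (UNIV::real set). hyperplane_of p \<in> \<G>}"
  let ?P = "\<lambda>\<G>. \<G> \<subseteq> Collect is_hyperplane \<and> openin ?T (?pre \<G>)"
  have int: "?P (S \<inter> T)" if "?P S" "?P T" for S T
  proof -
    have "?pre (S \<inter> T) = ?pre S \<inter> ?pre T" by blast
    moreover have "openin ?T (?pre S \<inter> ?pre T)"
      using that by (intro openin_Int) (rule conjunct2, assumption)+
    moreover have "S \<inter> T \<subseteq> Collect is_hyperplane"
      using that by (intro le_infI1) (rule conjunct1)
    ultimately show ?thesis by (simp only:)
  qed
  have un: "?P (\<Union>\<K>)" if "\<forall>S\<in>\<K>. ?P S" for \<K>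
  proof -
    have "?pre (\<Union>\<K>) = \<Union>(?pre ` \<K>)" by blast
    moreover have "openin ?T (\<Union>(?pre ` \<K>))"
    proof (rule openin_Union)
      fix A assume "A \<in> ?pre ` \<K>"
      then obtain S where "S \<in> \<K>" and A: "A = ?pre S" by (rule imageE)
      with that show "openin ?T A" unfolding A by simp
    qed
    moreover have "\<Union>\<K> \<subseteq> Collect is_hyperplane"
      using that by (intro Union_least) simp
    ultimately show ?thesis by (simp only:)
  qed
  have "istopology ?P" unfolding istopology_def
  proof (rule conjI; intro allI impI)
    show "?P (S \<inter> T)" if "?P S" "?P T" for S T using that by (rule int)
    show "?P (\<Union>\<K>)" if "\<forall>S\<in>\<K>. ?P S" for \<K> using that by (rule un)
  qed
  from topology_inverse'[OF this] show ?thesis unfolding hyperplane_topology_def by (rule fun_cong)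
qed

lemma is_hyperplane_hyperplane_of: "p \<in> sphere 0 1 \<times> UNIV \<Longrightarrow> is_hyperplane (hyperplane_of p)"
  unfolding is_hyperplane_def hyperplane_of_def
  by (intro exI[of _ "fst p"] exI[of _ "snd p"]) auto

lemma hyperplane_of_surj:
  assumes "is_hyperplane H"
  obtains p where "p \<in> sphere 0 1 \<times> UNIV" "H = hyperplane_of p"
proof -
  obtain a b where a: "a \<noteq> 0" and H: "H = {x. a \<bullet> x = b}"
    using assms unfolding is_hyperplane_def by blast
  have "H = hyperplane_of (a /\<^sub>R norm a, b / norm a)"
    using a by (auto simp: H hyperplane_of_def field_simps)
  moreover have "(a /\<^sub>R norm a, b / norm a) \<in> sphere 0 1 \<times> UNIV"
    using a by simp
  ultimately show ?thesis using that by blast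
qed

lemma topspace_hyperplane_topology [simp]: "topspace hyperplane_topology = Collect is_hyperplane"
proof -
  have "{p \<in> sphere 0 1 \<times> UNIV. hyperplane_of p \<in> Collect is_hyperplane}
      = sphere (0::'a) 1 \<times> (UNIV::real set)"
    using is_hyperplane_hyperplane_of by blast
  then have "openin hyperplane_topology (Collect (is_hyperplane :: 'a set \<Rightarrow> bool))"
    by (simp add: openin_hyperplane_topology)
  then show ?thesis
    by (metis openin_hyperplane_topology openin_subset openin_topspace subset_antisym)
qed

lemma quotient_map_hyperplane_of:
  "quotient_map (top_of_set (sphere 0 1 \<times> UNIV)) hyperplane_topology hyperplane_of"
  unfolding quotient_map_def
proof (intro conjI allI impI)
  show "hyperplane_of ` topspace (top_of_set (sphere (0::'a) 1 \<times> (UNIV::real set)))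
      = topspace hyperplane_topology"
    using is_hyperplane_hyperplane_of hyperplane_of_surj by (fastforce simp del: mem_sphere)
qed (simp add: openin_hyperplane_topology)

end

theory Submission
  imports Defs "HOL-Homology.Invariance_of_Domain"
begin

text \<open>A closed half-space \<open>{x. a \<bullet> x \<ge> b}\<close> is described by the nonzero vector \<open>p = (a, b)\<close> of \<open>\<real>\<^sup>d \<times> \<real>\<close>.
The excesses \<open>F i p = \<mu> i {x. a \<bullet> x \<ge> b} - 1/2\<close> are odd and, because hyperplanes are null sets, continuous
on the nonzero vectors. They have no common zero: for \<open>a \<noteq> 0\<close> it would be a simultaneous bisection, and for
\<open>a = 0\<close> the half-space is empty or everything. So at every \<open>p\<close> some signed excess \<open>\<plusminus>F j p\<close>
dominates all \<open>\<bar>F i p\<bar>\<close>. A signed index \<open>\<plusminus>j\<close> is called a label; negating \<open>p\<close> negates the dominant labels.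

Attach to the label \<open>\<plusminus>j\<close> over \<open>w\<close> the vector \<open>\<plusminus>(x w j, 1)\<close> of the \<open>d\<close>-dimensional space \<open>V \<times> \<real>\<close>.
The theorem asks for a \<open>p\<close>, a facet \<open>B\<close> of \<open>K\<close> such that \<open>G w\<close> contains the hyperplane of \<open>p\<close> for
all \<open>w\<close> in \<open>B\<close>, and labels on \<open>B\<close> dominant at \<open>p\<close> whose vectors have \<open>0\<close> in their convex hull. Indeed the
last coordinate then gives total weight \<open>1/2\<close> to each sign, and the other coordinates give a common point of the two
convex hulls (\<open>balanced_signs_hulls_meet\<close>). At a \<open>p\<close> with \<open>a = 0\<close> all dominant labels have the same sign, so no such
convex combination exists there. Hence these \<open>p\<close> may be admitted to the region of every \<open>w\<close>, and then
for every \<open>p \<noteq> 0\<close> the set of \<open>w\<close> whose region contains \<open>p\<close> is a member of \<open>L\<close>.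

The combination is first found approximately. The boundary of a cube in dimension \<open>d + 1\<close> is cut into small cells. For a cell
\<open>q\<close> let \<open>U q\<close> collect the \<open>w\<close> whose region meets \<open>q\<close>, and \<open>D q\<close> the labels that are dominant
somewhere on \<open>q\<close>. The complex \<open>K(U q; D q)\<close> is \<open>(d - 1)\<close>-connected and grows with \<open>q\<close>, and cells have
dimension at most \<open>d\<close>. Therefore a map from the boundary of the cube to the realization of the fiber complexes can be
built skeleton by skeleton, choosing freely on one cell of each antipodal pair and carrying the choice over to the other
(\<open>equivariant_map_carried_by_cells\<close>). Followed by the linear extension of the label vectors it is an odd map into
\<open>\<real>\<^sup>d\<close>, which has a zero by \<open>Borsuk_Ulam\<close>. The support of that zero projects to a face of \<open>K[U q]\<close>, which lies in a
facet of \<open>K[U q]\<close>, and this is a facet of \<open>K\<close> by admissibility (\<open>facet_of_balanced_labels\<close>).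
When the mesh tends to \<open>0\<close>, one facet and one labelling recur infinitely often, and compactness yields an exact solution
(\<open>common_point_of_nearly_meeting_closed_sets\<close>).

The Borsuk-Ulam theorem comes from the fact that odd self-maps of a sphere have odd degree. This is an induction on the dimension.
Homology theory compares, modulo \<open>2\<close>, the degree of an odd map with that of its restriction to the
equator, provided the equator is preserved; \<open>odd_map_deform_to_preserve_equator\<close> deforms an arbitrary odd map into one of this kind.\<close>

section \<open>Orthonormal frames\<close>

text \<open>Sequences supported on the coordinates \<open>0, \<dots>, n\<close> play the role of \<open>\<real>\<^sup>n\<^sup>+\<^sup>1\<close>,
so that the dimension may vary in an induction.\<close>

abbreviation sphere_set :: "nat \<Rightarrow> (nat \<Rightarrow> real) set" where
  "sphere_set n \<equiv> {x. (\<Sum>i\<le>n. (x i)\<^sup>2) = 1 \<and> (\<forall>i>n. x i = 0)}"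

lemma nsphere_eq_top_of_set: "nsphere n = top_of_set (sphere_set n)"
  by (simp add: nsphere euclidean_product_topology)

lemma continuous_on_coordinate [continuous_intros]:
  "continuous_on S (\<lambda>x. x i :: 'b::topological_space)"
  by (rule continuous_on_product_then_coordinatewise) (rule continuous_on_id)

text \<open>The degree of a map is defined for spheres of sequences, whereas polynomial approximation and the fact that differentiable
maps do not raise dimension concern Euclidean spaces. An orthonormal frame translates between the two by a
linear isometry, so it preserves oddness and the sphere.\<close>

definition frame_combine :: "(nat \<Rightarrow> 'a::euclidean_space) \<Rightarrow> nat \<Rightarrow> (nat \<Rightarrow> real) \<Rightarrow> 'a" where
  "frame_combine b n x = (\<Sum>i\<le>n. x i *\<^sub>R b i)"

definition frame_coords :: "(nat \<Rightarrow> 'a::euclidean_space) \<Rightarrow> nat \<Rightarrow> 'a \<Rightarrow> nat \<Rightarrow> real" where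
  "frame_coords b n v = (\<lambda>i. if i \<le> n then v \<bullet> b i else 0)"

definition orthonormal_frame :: "(nat \<Rightarrow> 'a::euclidean_space) \<Rightarrow> nat \<Rightarrow> bool" where
  "orthonormal_frame b n \<longleftrightarrow> (\<forall>i\<le>n. \<forall>j\<le>n. b i \<bullet> b j = (if i = j then 1 else 0))"

lemma frame_combine_inner:
  assumes "orthonormal_frame b n" "j \<le> n"
  shows "frame_combine b n x \<bullet> b j = x j"
proof -
  have "frame_combine b n x \<bullet> b j = (\<Sum>i\<le>n. x i * (b i \<bullet> b j))"
    by (simp add: frame_combine_def inner_sum_left)
  also have "\<dots> = (\<Sum>i\<le>n. if i = j then x i else 0)"
    using assms by (intro sum.cong) (auto simp: orthonormal_frame_def)
  also have "\<dots> = x j"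
    using assms by (simp add: sum.delta)
  finally show ?thesis .
qed

lemma norm_frame_combine:
  assumes "orthonormal_frame b n"
  shows "(norm (frame_combine b n x))\<^sup>2 = (\<Sum>i\<le>n. (x i)\<^sup>2)"
proof -
  have "(norm (frame_combine b n x))\<^sup>2 = frame_combine b n x \<bullet> (\<Sum>i\<le>n. x i *\<^sub>R b i)"
    by (simp add: power2_norm_eq_inner flip: frame_combine_def)
  also have "\<dots> = (\<Sum>i\<le>n. x i * x i)"
    using frame_combine_inner[OF assms] by (simp add: inner_sum_right)
  finally show ?thesis by (simp add: power2_eq_square)
qed

lemma frame_coords_combine:
  assumes "orthonormal_frame b n" "\<And>i. i > n \<Longrightarrow> x i = 0"
  shows "frame_coords b n (frame_combine b n x) = x"
  using assms frame_combine_inner[OF assms(1)] by (fastforce simp: frame_coords_def)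

lemma frame_combine_coords:
  assumes b: "orthonormal_frame b n" and v: "v \<in> span (b ` {..n})"
  shows "frame_combine b n (frame_coords b n v) = v"
  using v
proof (induction rule: span_induct_alt)
  case base
  then show ?case by (simp add: frame_combine_def frame_coords_def)
next
  case (step c u w)
  then obtain j where j: "j \<le> n" "u = b j" by auto
  have "(\<Sum>i\<le>n. (if i \<le> n then b j \<bullet> b i else 0) *\<^sub>R b i) = (\<Sum>i\<le>n. if i = j then b i else 0)"
    using b j by (intro sum.cong) (auto simp: orthonormal_frame_def)
  also have "\<dots> = b j" using j by simp
  finally have "frame_combine b n (frame_coords b n u) = u"
    by (simp add: frame_combine_def frame_coords_def j)
  moreover have "frame_combine b n (frame_coords b n (c *\<^sub>R u + w))
      = c *\<^sub>R frame_combine b n (frame_coords b n u) + frame_combine b n (frame_coords b n w)"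
    by (auto simp: frame_combine_def frame_coords_def inner_add_left algebra_simps
        sum.distrib scaleR_sum_right intro!: sum.cong)
  ultimately show ?case using step by simp
qed

lemma frame_combine_in_span: "frame_combine b n x \<in> span (b ` {..n})"
  unfolding frame_combine_def by (intro span_sum span_scale span_base) auto

lemma continuous_frame_combine: "continuous_on S (frame_combine b n)"
  unfolding frame_combine_def by (intro continuous_intros)

lemma continuous_frame_coords: "continuous_on S (frame_coords b n)"
proof (rule continuous_on_coordinatewise_then_product)
  show "continuous_on S (\<lambda>v. frame_coords b n v i)" for i
    by (cases "i \<le> n") (simp_all add: frame_coords_def continuous_intros)
qed

lemma frame_combine_sphere:
  assumes "orthonormal_frame b n"
  shows "frame_combine b n \<in> sphere_set n \<rightarrow> sphere 0 1 \<inter> span (b ` {..n})"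
proof
  fix x assume x: "x \<in> sphere_set n"
  have "(norm (frame_combine b n x))\<^sup>2 = 1"
    using x by (simp add: norm_frame_combine[OF assms])
  then have "norm (frame_combine b n x) = 1"
    by (simp add: power2_eq_1_iff) (smt (verit) norm_ge_zero)
  then show "frame_combine b n x \<in> sphere 0 1 \<inter> span (b ` {..n})"
    by (simp add: frame_combine_in_span)
qed

lemma frame_coords_sphere:
  assumes "orthonormal_frame b n"
  shows "frame_coords b n \<in> sphere 0 1 \<inter> span (b ` {..n}) \<rightarrow> sphere_set n"
proof
  fix v assume v: "v \<in> sphere 0 1 \<inter> span (b ` {..n})"
  have "(\<Sum>i\<le>n. (frame_coords b n v i)\<^sup>2) = (norm v)\<^sup>2"
    using norm_frame_combine[OF assms, of "frame_coords b n v"] v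
    by (simp add: frame_combine_coords[OF assms])
  then show "frame_coords b n v \<in> sphere_set n"
    using v by (simp add: frame_coords_def)
qed

lemma frame_combine_minus: "frame_combine b n (\<lambda>i. - x i) = - frame_combine b n x"
  by (simp add: frame_combine_def sum_negf)

lemma frame_coords_minus: "frame_coords b n (- v) = (\<lambda>i. - frame_coords b n v i)"
  by (auto simp: frame_coords_def)

section \<open>Odd maps of spheres and the Borsuk-Ulam theorem\<close>

text \<open>The sphere of dimension \<open>0\<close> has two points, which an odd map either fixes or exchanges.\<close>

lemma odd_map_sphere_0_degree:
  assumes h: "continuous_map (nsphere 0) (nsphere 0) h"
    and odd: "\<forall>x\<in>sphere_set 0. h (\<lambda>i. - x i) = (\<lambda>i. - h x i)"
  shows "odd (Brouwer_degree2 0 h)"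
proof -
  define e :: "nat \<Rightarrow> real" where "e = (\<lambda>i. if i = 0 then 1 else 0)"
  have S: "x = e \<or> x = (\<lambda>i. - e i)" if "x \<in> sphere_set 0" for x
  proof -
    have "x 0 = 1 \<or> x 0 = -1" using that by (auto simp: power2_eq_1_iff)
    then show ?thesis
      using that by (auto simp: e_def fun_eq_iff)
  qed
  have e: "e \<in> sphere_set 0" by (simp add: e_def)
  then have "h e \<in> sphere_set 0"
    using h by (auto simp: nsphere_eq_top_of_set continuous_map_in_subtopology Pi_iff)
  then consider "h e = e" | "h e = (\<lambda>i. - e i)" using S by blast
  then have "homeomorphic_maps (nsphere 0) (nsphere 0) h h"
  proof cases
    case 1
    then have "h x = x" if "x \<in> sphere_set 0" for x
      using S[OF that] bspec[OF odd e] by auto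
    then show ?thesis using h by (auto simp: homeomorphic_maps_def nsphere_eq_top_of_set)
  next
    case 2
    then have "h x = (\<lambda>i. - x i)" if "x \<in> sphere_set 0" for x
      using S[OF that] bspec[OF odd e] by auto
    then show ?thesis using h by (auto simp: homeomorphic_maps_def nsphere_eq_top_of_set)
  qed
  then show ?thesis
    by (rule Brouwer_degree2_homeomorphic_maps) (metis dvd_abs_iff odd_one)
qed

text \<open>The straight-line homotopy avoids \<open>0\<close> and is projected radially to the sphere.\<close>

lemma homotopic_normalize:
  fixes f g :: "'b::topological_space \<Rightarrow> 'a::euclidean_space"
  assumes f: "continuous_on X f" and g: "continuous_on X g"
    and T: "subspace T" "f \<in> X \<rightarrow> T" "g \<in> X \<rightarrow> T"
    and nz: "\<And>x. x \<in> X \<Longrightarrow> 0 \<notin> closed_segment (f x) (g x)"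
  shows "homotopic_with_canon (\<lambda>_. True) X (sphere 0 1 \<inter> T)
    (\<lambda>x. f x /\<^sub>R norm (f x)) (\<lambda>x. g x /\<^sub>R norm (g x))"
proof -
  have "homotopic_with_canon (\<lambda>_. True) X (T - {0}) f g"
  proof (rule homotopic_with_linear[OF f g])
    show "closed_segment (f x) (g x) \<subseteq> T - {0}" if "x \<in> X" for x
    proof -
      have "closed_segment (f x) (g x) \<subseteq> T"
        using T that by (intro closed_segment_subset subspace_imp_convex) auto
      then show ?thesis using nz[OF that] by blast
    qed
  qed
  moreover have "continuous_on (T - {0}) (\<lambda>v::'a. v /\<^sub>R norm v)"
    by (intro continuous_intros) auto
  moreover have "(\<lambda>v. v /\<^sub>R norm v) \<in> T - {0} \<rightarrow> sphere 0 1 \<inter> T"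
    using T(1) by (auto simp: subspace_scale)
  ultimately have "homotopic_with_canon (\<lambda>_. True) X (sphere 0 1 \<inter> T)
      ((\<lambda>v. v /\<^sub>R norm v) \<circ> f) ((\<lambda>v. v /\<^sub>R norm v) \<circ> g)"
    by (rule homotopic_with_compose_continuous_left)
  then show ?thesis by (simp add: comp_def)
qed

text \<open>The odd part of a Weierstrass approximation of an odd map is as good an approximation as the original
polynomial, by the triangle inequality.\<close>

lemma exists_odd_polynomial_approximation:
  fixes k :: "'a::euclidean_space \<Rightarrow> 'a"
  assumes "compact X" "continuous_on X k" "0 < e" "subspace T" "k ` X \<subseteq> T"
    and odd: "\<And>x. x \<in> X \<Longrightarrow> - x \<in> X \<and> k (- x) = - k x"
  obtains p where "polynomial_function p" "p ` X \<subseteq> T" "\<And>x. p (- x) = - p x"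
    "\<And>x. x \<in> X \<Longrightarrow> norm (k x - p x) < e"
proof -
  obtain g where g: "polynomial_function g" "g ` X \<subseteq> T"
    and close: "\<And>x. x \<in> X \<Longrightarrow> norm (k x - g x) < e"
    using Stone_Weierstrass_polynomial_function_subspace[OF assms(1-5)] by blast
  define p where "p x = (1/2) *\<^sub>R (g x - g (- x))" for x
  show thesis
  proof
    have "polynomial_function (g \<circ> uminus)"
      using g(1) by (intro polynomial_function_compose polynomial_function_minus polynomial_function_id)
    then show "polynomial_function p"
      unfolding p_def using g(1)
      by (intro polynomial_function_cmul polynomial_function_diff) (simp_all add: comp_def)
    show "p ` X \<subseteq> T"
      using g(2) odd assms(4) by (auto simp: p_def intro!: subspace_scale subspace_diff)
    show "p (- x) = - p x" for x by (simp add: p_def algebra_simps)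
    show "norm (k x - p x) < e" if x: "x \<in> X" for x
    proof -
      have "k x - p x = (1/2) *\<^sub>R ((k x - g x) - (k (- x) - g (- x)))"
        using odd[OF x] by (simp add: p_def algebra_simps flip: scaleR_add_left)
      then have "norm (k x - p x) \<le> (norm (k x - g x) + norm (k (- x) - g (- x))) / 2"
        using norm_triangle_ineq4[of "k x - g x" "k (- x) - g (- x)"] by simp
      moreover have "norm (k (- x) - g (- x)) < e" using close odd[OF x] by blast
      ultimately show ?thesis using close[OF x] by (simp add: field_simps)
    qed
  qed
qed

text \<open>The reflection in the hyperplane orthogonal to \<open>c\<close>; since division by \<open>0\<close> gives \<open>0\<close>, it is the identity for \<open>c = 0\<close>.\<close>

definition reflection :: "'a::euclidean_space \<Rightarrow> 'a \<Rightarrow> 'a" where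
  "reflection c v = v - (2 * (v \<bullet> c) / (c \<bullet> c)) *\<^sub>R c"

lemma reflection_reflection [simp]: "reflection c (reflection c v) = v"
  by (cases "c = 0") (simp_all add: reflection_def inner_diff_left field_simps)

lemma reflection_minus: "reflection c (- v) = - reflection c v"
  by (simp add: reflection_def)

lemma inner_reflection: "reflection c u \<bullet> v = u \<bullet> reflection c v"
  by (simp add: reflection_def inner_diff_left inner_diff_right inner_commute)

lemma norm_reflection [simp]: "norm (reflection c v) = norm v"
  by (simp add: norm_eq_sqrt_inner inner_reflection)

lemma reflection_swaps:
  assumes "norm a = 1" "norm e = 1"
  shows "reflection (a - e) e = a"
proof (cases "a = e")
  case False
  have n: "a \<bullet> a = 1" "e \<bullet> e = 1" using assms by (simp_all add: norm_eq_1)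
  have c: "(a - e) \<bullet> (a - e) = 2 - 2 * (a \<bullet> e)" "e \<bullet> (a - e) = a \<bullet> e - 1"
    using n by (simp_all add: inner_diff_left inner_diff_right inner_commute)
  have "(a - e) \<bullet> (a - e) \<noteq> 0" using False by simp
  then have "2 * (e \<bullet> (a - e)) / ((a - e) \<bullet> (a - e)) = -1"
    unfolding c by (simp add: field_simps)
  then show ?thesis by (simp add: reflection_def)
qed (simp add: reflection_def)

lemma continuous_reflection: "continuous_on X (reflection c)"
proof (cases "c = 0")
  case False
  then show ?thesis unfolding reflection_def by (intro continuous_intros) auto
qed (simp add: reflection_def continuous_intros)

lemma reflection_in_subspace: "\<lbrakk>subspace T; c \<in> T; v \<in> T\<rbrakk> \<Longrightarrow> reflection c v \<in> T"
  unfolding reflection_def by (intro subspace_diff subspace_scale)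

lemma orthonormal_frame_span_orthogonal:
  assumes b: "orthonormal_frame b (Suc n)" and v: "v \<in> span (b ` {..n})"
  shows "v \<bullet> b (Suc n) = 0"
  using v
proof (induction rule: span_induct_alt)
  case (step c u w)
  then obtain j where "j \<le> n" "u = b j" by auto
  then have "u \<bullet> b (Suc n) = 0" using b by (auto simp: orthonormal_frame_def)
  then show ?case using step by (simp add: inner_add_left)
qed simp

lemma orthonormal_frame_span_lower:
  assumes b: "orthonormal_frame b (Suc n)" and v: "v \<in> span (b ` {..Suc n})"
    and o: "v \<bullet> b (Suc n) = 0"
  shows "v \<in> span (b ` {..n})"
proof -
  have "v = frame_combine b (Suc n) (frame_coords b (Suc n) v)"
    by (simp add: frame_combine_coords[OF b v])
  also have "\<dots> = frame_combine b n (frame_coords b (Suc n) v)"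
    using o by (simp add: frame_combine_def frame_coords_def)
  finally show ?thesis using frame_combine_in_span by metis
qed

lemma orthonormal_frame_dim_less:
  assumes b: "orthonormal_frame b (Suc n)"
  shows "dim (span (b ` {..n})) < dim (span (b ` {..Suc n}))"
proof -
  have "b (Suc n) \<notin> span (b ` {..n})"
  proof
    assume "b (Suc n) \<in> span (b ` {..n})"
    then have "b (Suc n) \<bullet> b (Suc n) = 0" by (rule orthonormal_frame_span_orthogonal[OF b])
    moreover have "b (Suc n) \<bullet> b (Suc n) = 1"
      using b unfolding orthonormal_frame_def by (metis order_refl)
    ultimately show False by simp
  qed
  moreover have "b (Suc n) \<in> span (b ` {..Suc n})" by (simp add: span_base)
  moreover have "span (b ` {..n}) \<subseteq> span (b ` {..Suc n})" by (intro span_mono) auto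
  ultimately have "span (b ` {..n}) \<subset> span (b ` {..Suc n})" by blast
  then show ?thesis by (metis dim_psubset dim_span)
qed

text \<open>Approximate the map by an odd polynomial map \<open>p\<close>. On the equator \<open>p\<close> is differentiable, so its directions cannot fill the
sphere, whose dimension is higher; they miss a point \<open>a\<close>, and by oddness also \<open>- a\<close>. Removing the \<open>a\<close>-component of
\<open>p\<close>, completely on the equator and only partly elsewhere, therefore never produces \<open>0\<close>, and it sends the
equator into the hyperplane orthogonal to \<open>a\<close>. A reflection then moves \<open>a\<close> to the pole \<open>e\<close>. The homotopies keep the degree, and the
reflection changes it at most by a sign.\<close>

lemma odd_map_deform_to_preserve_equator:
  fixes b :: "nat \<Rightarrow> 'a::euclidean_space"
  assumes b: "orthonormal_frame b (Suc n)"
    and h: "continuous_map (nsphere (Suc n)) (nsphere (Suc n)) h"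
    and h_odd: "\<forall>x\<in>sphere_set (Suc n). h (\<lambda>i. - x i) = (\<lambda>i. - h x i)"
  obtains h' where "continuous_map (nsphere (Suc n)) (nsphere (Suc n)) h'"
    "\<forall>x\<in>sphere_set (Suc n). h' (\<lambda>i. - x i) = (\<lambda>i. - h' x i)"
    "h' \<in> sphere_set n \<rightarrow> sphere_set n"
    "\<bar>Brouwer_degree2 (Suc n) h'\<bar> = \<bar>Brouwer_degree2 (Suc n) h\<bar>"
proof -
  define N where "N = Suc n"
  define J where "J = frame_combine b N"
  define I where "I = frame_coords b N"
  define T where "T = span (b ` {..N})"
  define E where "E = span (b ` {..n})"
  define X where "X = sphere 0 1 \<inter> T"
  define e where "e = b N"
  have sub: "subspace T" "subspace E" by (simp_all add: T_def E_def)
  have "E \<subseteq> T" unfolding E_def T_def N_def by (intro span_mono) auto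
  have e: "norm e = 1" "e \<in> T"
    using b by (auto simp: e_def N_def T_def orthonormal_frame_def norm_eq_1 intro: span_base)
  have J: "continuous_map (nsphere N) (top_of_set X) J"
    using frame_combine_sphere[OF b]
    by (simp add: nsphere_eq_top_of_set J_def N_def X_def T_def continuous_frame_combine)
  have I: "continuous_map (top_of_set X) (nsphere N) I"
    using frame_coords_sphere[OF b]
    by (simp add: nsphere_eq_top_of_set I_def N_def X_def T_def continuous_frame_coords)
  have IJ: "I (J x) = x" if "x \<in> sphere_set N" for x
    using that unfolding I_def J_def N_def by (intro frame_coords_combine[OF b]) auto
  have JI: "J (I v) = v" if "v \<in> X" for v
    using that unfolding I_def J_def N_def X_def T_def by (intro frame_combine_coords[OF b]) auto
  have JX: "J x \<in> X" if "x \<in> sphere_set N" for x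
    using J that by (auto simp: nsphere_eq_top_of_set)
  have IX: "I v \<in> sphere_set N" if "v \<in> X" for v
    using I that by (auto simp: nsphere_eq_top_of_set)
  have X_minus: "- v \<in> X" if "v \<in> X" for v
    using that sub by (auto simp: X_def subspace_neg)
  define k where "k = J \<circ> h \<circ> I"
  have "continuous_map (top_of_set X) (top_of_set X) k"
    unfolding k_def using h by (intro continuous_map_compose[OF I] continuous_map_compose[OF _ J]) (simp add: N_def)
  then have k: "continuous_on X k" "k \<in> X \<rightarrow> X" by auto
  have k_odd: "k (- v) = - k v" if "v \<in> X" for v
    using bspec[OF h_odd, of "I v"] IX[OF that]
    by (simp add: k_def I_def J_def N_def frame_coords_minus frame_combine_minus)
  have "compact X" using sub by (simp add: X_def compact_Int_closed closed_subspace)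
  have "k ` X \<subseteq> T" using k by (auto simp: X_def)
  obtain p where p: "polynomial_function p" "p ` X \<subseteq> T" and p_odd: "\<And>x. p (- x) = - p x"
    and close: "\<And>x. x \<in> X \<Longrightarrow> norm (k x - p x) < 1"
    using exists_odd_polynomial_approximation[OF \<open>compact X\<close> k(1) zero_less_one sub(1) \<open>k ` X \<subseteq> T\<close>]
      X_minus k_odd by metis
  have norm_k: "norm (k x) = 1" if "x \<in> X" for x using k(2) that by (auto simp: X_def)
  have seg_k: "0 \<notin> closed_segment (k x) (p x)" if "x \<in> X" for x
    using dist_in_closed_segment[of 0 "k x" "p x"] close[OF that] norm_k[OF that]
    by (auto simp: dist_norm)
  have p0: "p x \<noteq> 0" if "x \<in> X" for x using seg_k[OF that] by auto
  define q where "q x = p x /\<^sub>R norm (p x)" for x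
  have EX: "sphere 0 1 \<inter> E \<subseteq> X" using \<open>E \<subseteq> T\<close> by (auto simp: X_def)
  have "q differentiable_on sphere 0 1 \<inter> E"
  proof -
    have "p differentiable_on sphere 0 1 \<inter> E"
      using p(1) by (simp add: differentiable_on_polynomial_function)
    then show ?thesis
      unfolding q_def using p0 EX
      by (fastforce intro: derivative_intros differentiable_on_compose[of p])
  qed
  then have "q ` (sphere 0 1 \<inter> E) \<noteq> X"
    unfolding X_def using \<open>E \<subseteq> T\<close> sub orthonormal_frame_dim_less[OF b]
    by (intro spheremap_lemma1) (auto simp: E_def T_def N_def)
  moreover have "q ` (sphere 0 1 \<inter> E) \<subseteq> X"
    proof
    fix v assume "v \<in> q ` (sphere 0 1 \<inter> E)"
    then obtain x where "x \<in> X" "v = q x" using EX by blast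
    then show "v \<in> X"
    proof -
      have "p x \<in> T" using p(2) \<open>x \<in> X\<close> by blast
      then have "q x \<in> T" unfolding q_def by (rule subspace_scale[OF sub(1)])
      then show ?thesis using p0[OF \<open>x \<in> X\<close>] by (simp add: X_def q_def \<open>v = q x\<close>)
    qed
  qed
  ultimately obtain a where a: "a \<in> X" "a \<notin> q ` (sphere 0 1 \<inter> E)" by blast
  have an: "norm a = 1" "a \<bullet> a = 1" "a \<in> T" using a by (auto simp: X_def norm_eq_1)
  \<comment> \<open>The factor \<open>1 - (x \<bullet> e)\<^sup>2\<close> is even in \<open>x\<close>, and it equals \<open>1\<close> exactly on the equator.\<close>
  define g where "g x = p x - ((1 - (x \<bullet> e)\<^sup>2) * (p x \<bullet> a)) *\<^sub>R a" for x
  have g_odd: "g (- x) = - g x" for x by (simp add: g_def p_odd)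
  have seg_g: "0 \<notin> closed_segment (p x) (g x)" if x: "x \<in> X" for x
  proof
    assume "0 \<in> closed_segment (p x) (g x)"
    then obtain t where t: "0 \<le> t" "t \<le> 1" "0 = (1 - t) *\<^sub>R p x + t *\<^sub>R g x"
      by (auto simp: in_segment)
    define c where "c = t * (1 - (x \<bullet> e)\<^sup>2)"
    have px: "p x = (c * (p x \<bullet> a)) *\<^sub>R a"
      using t(3) by (simp add: g_def c_def algebra_simps)
    then have "p x \<bullet> a \<noteq> 0" using p0[OF x] by auto
    moreover have "p x \<bullet> a = c * (p x \<bullet> a)"
      using arg_cong[OF px, of "\<lambda>v. v \<bullet> a"] an(2) by simp
    ultimately have "c = 1" by simp
    then have c1: "t * (1 - (x \<bullet> e)\<^sup>2) = 1" by (simp add: c_def)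
    have "1 - (x \<bullet> e)\<^sup>2 > 0"
    proof (rule ccontr)
      assume "\<not> 1 - (x \<bullet> e)\<^sup>2 > 0"
      then have "t * (1 - (x \<bullet> e)\<^sup>2) \<le> 0" using t(1) by (intro mult_nonneg_nonpos) auto
      then show False using c1 by simp
    qed
    then have "t * (1 - (x \<bullet> e)\<^sup>2) \<le> 1 * (1 - (x \<bullet> e)\<^sup>2)"
      using t(2) by (intro mult_right_mono) auto
    then have "(x \<bullet> e)\<^sup>2 \<le> 0" using c1 by simp
    then have xe: "x \<bullet> e = 0" by simp
    then have xE: "x \<in> sphere 0 1 \<inter> E"
      using orthonormal_frame_span_lower[OF b, of x] x by (auto simp: X_def T_def E_def N_def e_def)
    then have mxE: "- x \<in> sphere 0 1 \<inter> E" using sub by (auto simp: subspace_neg)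
    define r where "r = p x \<bullet> a"
    have pr: "p x = r *\<^sub>R a" using px \<open>c = 1\<close> by (simp add: r_def)
    have "q x = a \<or> q (- x) = a"
      using \<open>p x \<bullet> a \<noteq> 0\<close> an(1) by (cases "r > 0") (auto simp: q_def p_odd pr simp flip: r_def)
    then show False using a(2) xE mxE by blast
  qed
  have g0: "g x \<noteq> 0" if "x \<in> X" for x using seg_g[OF that] by auto
  have gT: "g \<in> X \<rightarrow> T"
    unfolding g_def using p(2) an(3) sub by (auto intro!: subspace_diff subspace_scale)
  have cp: "continuous_on X p" using p(1) by (rule continuous_on_polymonial_function)
  moreover have "continuous_on X g" unfolding g_def by (intro continuous_intros cp)
  ultimately have cont: "continuous_on X p" "continuous_on X g" .
  have "homotopic_with_canon (\<lambda>_. True) X X (\<lambda>x. k x /\<^sub>R norm (k x)) (\<lambda>x. p x /\<^sub>R norm (p x))"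
    using homotopic_normalize[OF k(1) cont(1) sub(1) _ _ seg_k] \<open>k ` X \<subseteq> T\<close> p(2)
    by (auto simp flip: X_def)
  moreover have "homotopic_with_canon (\<lambda>_. True) X X (\<lambda>x. p x /\<^sub>R norm (p x)) (\<lambda>x. g x /\<^sub>R norm (g x))"
    using homotopic_normalize[OF cont sub(1) _ gT seg_g] p(2) by (auto simp flip: X_def)
  ultimately have hom: "homotopic_with_canon (\<lambda>_. True) X X (\<lambda>x. k x /\<^sub>R norm (k x)) (\<lambda>x. g x /\<^sub>R norm (g x))"
    by (rule homotopic_with_trans)
  define G where "G x = g x /\<^sub>R norm (g x)" for x
  have G: "continuous_map (top_of_set X) (top_of_set X) G"
    using homotopic_with_imp_continuous_maps[OF hom] by (simp add: G_def[abs_def])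
  have "homotopic_with (\<lambda>_. True) (nsphere N) (nsphere N)
      (I \<circ> ((\<lambda>x. k x /\<^sub>R norm (k x)) \<circ> J)) (I \<circ> (G \<circ> J))"
    using hom unfolding G_def[abs_def]
    by (intro homotopic_with_compose_continuous_map_left[OF _ I]
        homotopic_with_compose_continuous_map_right[OF _ J]) auto
  then have "Brouwer_degree2 N (I \<circ> ((\<lambda>x. k x /\<^sub>R norm (k x)) \<circ> J)) = Brouwer_degree2 N (I \<circ> (G \<circ> J))"
    by (rule Brouwer_degree2_homotopic)
  moreover have hN: "h x \<in> sphere_set N" if "x \<in> sphere_set N" for x
    using h that by (auto simp: nsphere_eq_top_of_set N_def)
  have "Brouwer_degree2 N (I \<circ> ((\<lambda>x. k x /\<^sub>R norm (k x)) \<circ> J)) = Brouwer_degree2 N h"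
  proof (intro Brouwer_degree2_eq)
    fix x assume "x \<in> topspace (nsphere N)"
    then have x: "x \<in> sphere_set N" by (simp add: nsphere_eq_top_of_set)
    then have "k (J x) = J (h x)" by (simp only: k_def comp_apply IJ)
    then show "(I \<circ> ((\<lambda>x. k x /\<^sub>R norm (k x)) \<circ> J)) x = h x"
      using norm_k[OF JX[OF x]] IJ[OF hN[OF x]] by simp
  qed
  ultimately have deg_G: "Brouwer_degree2 N (I \<circ> (G \<circ> J)) = Brouwer_degree2 N h" by simp
  define R where "R = reflection (a - e)"
  have R: "continuous_map (top_of_set X) (top_of_set X) R"
  proof -
    have "R v \<in> X" if "v \<in> X" for v
      using that reflection_in_subspace[OF sub(1) subspace_diff[OF sub(1) an(3) e(2)]]
      by (simp add: X_def R_def)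
    then show ?thesis by (auto simp: R_def continuous_reflection)
  qed
  define \<rho> where "\<rho> = I \<circ> (R \<circ> J)"
  have \<rho>: "continuous_map (nsphere N) (nsphere N) \<rho>"
    unfolding \<rho>_def by (intro continuous_map_compose[OF _ I] continuous_map_compose[OF J R])
  have RX: "R v \<in> X" if "v \<in> X" for v using R that by auto
  have "\<rho> (\<rho> x) = x" if "x \<in> sphere_set N" for x
    using JX[OF that] RX IJ[OF that] by (simp add: \<rho>_def JI R_def)
  then have "homeomorphic_maps (nsphere N) (nsphere N) \<rho> \<rho>"
    using \<rho> by (simp add: homeomorphic_maps_def nsphere_eq_top_of_set)
  then have deg_\<rho>: "\<bar>Brouwer_degree2 N \<rho>\<bar> = 1"
    by (rule Brouwer_degree2_homeomorphic_maps)
  have cG: "continuous_map (nsphere N) (nsphere N) (I \<circ> (G \<circ> J))"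
    by (intro continuous_map_compose[OF _ I] continuous_map_compose[OF J G])
  define h' where "h' = \<rho> \<circ> (I \<circ> (G \<circ> J))"
  have h': "continuous_map (nsphere N) (nsphere N) h'"
    unfolding h'_def by (intro continuous_map_compose[OF cG \<rho>])
  have GX: "G v \<in> X" if "v \<in> X" for v using G that by auto
  have h'_eq: "h' x = I (R (G (J x)))" if "x \<in> sphere_set N" for x
    using GX[OF JX[OF that]] by (simp add: h'_def \<rho>_def JI)
  show thesis
  proof
    show "continuous_map (nsphere (Suc n)) (nsphere (Suc n)) h'" using h' by (simp add: N_def)
    show "\<forall>x\<in>sphere_set (Suc n). h' (\<lambda>i. - x i) = (\<lambda>i. - h' x i)"
    proof
      fix x assume that: "x \<in> sphere_set (Suc n)"
      have "(\<lambda>i. - x i) \<in> sphere_set N" using that by (simp add: N_def)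
      moreover have "J (\<lambda>i. - x i) = - J x" by (simp add: J_def frame_combine_minus)
      ultimately show "h' (\<lambda>i. - x i) = (\<lambda>i. - h' x i)" using that
        unfolding N_def[symmetric]
        by (simp only: h'_eq G_def g_odd norm_minus_cancel scaleR_minus_right R_def reflection_minus
            I_def frame_coords_minus)
    qed
    show "h' \<in> sphere_set n \<rightarrow> sphere_set n"
    proof
      fix x assume x: "x \<in> sphere_set n"
      then have xN: "x \<in> sphere_set N" by (simp add: N_def)
      have "J x \<bullet> e = 0"
        using frame_combine_inner[OF b, of "Suc n" x] x by (simp add: J_def N_def e_def)
      then have "g (J x) \<bullet> a = 0" by (simp add: g_def inner_diff_left an)
      then have "R (G (J x)) \<bullet> e = 0"
        by (simp add: R_def inner_reflection reflection_swaps an e G_def)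
      then have "h' x (Suc n) = 0" by (simp add: h'_eq[OF xN] I_def frame_coords_def e_def N_def)
      moreover have "h' x \<in> sphere_set N" using h' xN by (auto simp: nsphere_eq_top_of_set)
      moreover have "h' x i = 0" if "i > n" for i
        using \<open>h' x (Suc n) = 0\<close> \<open>h' x \<in> sphere_set N\<close> that
        by (cases "i = Suc n") (auto simp: N_def)
      ultimately show "h' x \<in> sphere_set n" by (simp add: N_def)
    qed
    show "\<bar>Brouwer_degree2 (Suc n) h'\<bar> = \<bar>Brouwer_degree2 (Suc n) h\<bar>"
      using Brouwer_degree2_compose[OF cG \<rho>] deg_\<rho> deg_G by (simp add: h'_def N_def abs_mult)
  qed
qed

text \<open>The deformed map restricts to an odd self-map of the equator, so the induction hypothesis applies to the restriction.
The frame only records that some Euclidean space of dimension larger than \<open>n\<close> is at hand.\<close>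

theorem odd_sphere_map_has_odd_degree:
  fixes b :: "nat \<Rightarrow> 'a::euclidean_space"
  assumes "orthonormal_frame b n"
    and "continuous_map (nsphere n) (nsphere n) h"
    and "\<forall>x\<in>sphere_set n. h (\<lambda>i. - x i) = (\<lambda>i. - h x i)"
  shows "odd (Brouwer_degree2 n h)"
  using assms
proof (induction n arbitrary: h)
  case 0
  then show ?case by (intro odd_map_sphere_0_degree)
next
  case (Suc n)
  obtain h' where h': "continuous_map (nsphere (Suc n)) (nsphere (Suc n)) h'"
    "\<forall>x\<in>sphere_set (Suc n). h' (\<lambda>i. - x i) = (\<lambda>i. - h' x i)"
    "h' \<in> sphere_set n \<rightarrow> sphere_set n"
    "\<bar>Brouwer_degree2 (Suc n) h'\<bar> = \<bar>Brouwer_degree2 (Suc n) h\<bar>"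
    by (rule odd_map_deform_to_preserve_equator[of b n h, OF Suc.prems])
  have "even (Brouwer_degree2 (Suc n) h' - Brouwer_degree2 (Suc n - Suc 0) h')"
    using h'(2,3) by (intro Borsuk_odd_mapping_degree_step[OF h'(1)]) (auto simp: nsphere_eq_top_of_set)
  moreover have "odd (Brouwer_degree2 n h')"
  proof (rule Suc.IH)
    show "orthonormal_frame b n" using Suc.prems(1) by (auto simp: orthonormal_frame_def)
    have "sphere_set n \<subseteq> sphere_set (Suc n)" by auto
    then show "continuous_map (nsphere n) (nsphere n) h'"
      using h'(1,3) by (auto simp: nsphere_eq_top_of_set intro: continuous_on_subset)
    show "\<forall>x\<in>sphere_set n. h' (\<lambda>i. - x i) = (\<lambda>i. - h' x i)"
      using h'(2) by auto
  qed
  ultimately have "odd (Brouwer_degree2 (Suc n) h')" by auto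
  then show ?case using h'(4) by (metis dvd_abs_iff)
qed

text \<open>If \<open>\<phi>\<close> had no zero, normalizing it would give an odd map of the sphere into its own equator. Its degree would be odd,
but also zero since the map is not surjective.\<close>

theorem Borsuk_Ulam:
  fixes b :: "nat \<Rightarrow> 'a::euclidean_space" and \<phi> :: "(nat \<Rightarrow> real) \<Rightarrow> nat \<Rightarrow> real"
  assumes b: "orthonormal_frame b n"
    and cont: "continuous_on (sphere_set n) \<phi>"
    and odd: "\<forall>x\<in>sphere_set n. \<phi> (\<lambda>i. - x i) = (\<lambda>i. - \<phi> x i)"
    and low: "\<And>x i. x \<in> sphere_set n \<Longrightarrow> i \<ge> n \<Longrightarrow> \<phi> x i = 0"
  shows "\<exists>x\<in>sphere_set n. \<phi> x = (\<lambda>_. 0)"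
proof (rule ccontr)
  assume "\<not> ?thesis"
  then have nz: "\<phi> x \<noteq> (\<lambda>_. 0)" if "x \<in> sphere_set n" for x using that by blast
  define r where "r x = (\<Sum>i\<le>n. (\<phi> x i)\<^sup>2)" for x
  have r: "r x > 0" if x: "x \<in> sphere_set n" for x
  proof -
    obtain i where i: "\<phi> x i \<noteq> 0" using nz[OF x] by auto
    then have "i \<le> n" using low[OF x, of i] by (meson le_cases)
    then show ?thesis unfolding r_def using i by (intro sum_pos2[where i=i]) auto
  qed
  define h where "h x = (\<lambda>i. \<phi> x i / sqrt (r x))" for x
  have h: "h x \<in> sphere_set n" "h x n = 0" if x: "x \<in> sphere_set n" for x
  proof -
    have "(\<Sum>i\<le>n. (h x i)\<^sup>2) = (\<Sum>i\<le>n. (\<phi> x i)\<^sup>2 / r x)"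
      using r[OF x] by (intro sum.cong) (simp_all add: h_def power_divide)
    also have "\<dots> = r x / r x" by (simp add: r_def flip: sum_divide_distrib)
    finally have "(\<Sum>i\<le>n. (h x i)\<^sup>2) = r x / r x" .
    then show "h x \<in> sphere_set n" using r[OF x] low[OF x] by (simp add: h_def)
    show "h x n = 0" using low[OF x] by (simp add: h_def)
  qed
  have "continuous_on (sphere_set n) h"
    unfolding h_def
  proof (intro continuous_on_coordinatewise_then_product continuous_intros)
    show "continuous_on (sphere_set n) (\<lambda>x. \<phi> x i)" for i
      using cont by (rule continuous_on_product_then_coordinatewise)
    then show "continuous_on (sphere_set n) r"
      unfolding r_def by (intro continuous_intros)
    show "\<forall>x\<in>sphere_set n. sqrt (r x) \<noteq> 0" using r by fastforce
  qed
  then have ch: "continuous_map (nsphere n) (nsphere n) h"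
    using h(1) by (auto simp: nsphere_eq_top_of_set)
  have "\<forall>x\<in>sphere_set n. h (\<lambda>i. - x i) = (\<lambda>i. - h x i)"
  proof
    fix x assume "x \<in> sphere_set n"
    then have "\<phi> (\<lambda>i. - x i) = (\<lambda>i. - \<phi> x i)" using odd by blast
    then show "h (\<lambda>i. - x i) = (\<lambda>i. - h x i)" unfolding h_def r_def by simp
  qed
  then have "odd (Brouwer_degree2 n h)"
    by (rule odd_sphere_map_has_odd_degree[OF b ch])
  moreover have "h ` sphere_set n \<noteq> sphere_set n"
  proof
    assume onto: "h ` sphere_set n = sphere_set n"
    define e :: "nat \<Rightarrow> real" where "e = (\<lambda>i. if i = n then 1 else 0)"
    have "(\<Sum>i\<le>n. (e i)\<^sup>2) = (\<Sum>i\<le>n. if i = n then 1 else 0)"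
      unfolding e_def by (intro sum.cong) auto
    then have "e \<in> sphere_set n" by (simp add: e_def)
    then have "e \<in> h ` sphere_set n" by (simp only: onto)
    then obtain x where x: "e = h x" "x \<in> sphere_set n" by (rule imageE)
    then have "e n = 0" using h(2)[OF x(2)] by simp
    then show False by (simp add: e_def)
  qed
  then have "h ` topspace (nsphere n) \<noteq> topspace (nsphere n)"
    by (simp add: nsphere_eq_top_of_set)
  then obtain c where "homotopic_with (\<lambda>x. True) (nsphere n) (nsphere n) h (\<lambda>x. c)"
    by (rule nullhomotopic_nonsurjective_sphere_map[OF ch])
  then have "Brouwer_degree2 n h = 0" by (rule Brouwer_degree2_nullhomotopic)
  ultimately show False by simp
qed

section \<open>Cubical cells\<close>

text \<open>Subdivide the real line at the even integers. Each even integer is a cell, and the open interval from \<open>2 * k\<close> to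
\<open>2 * k + 2\<close> is the cell with the name \<open>2 * k + 1\<close>. The formula gives the name of the cell that contains \<open>r\<close>
and is visibly odd in \<open>r\<close>.\<close>

definition carrier_coord :: "real \<Rightarrow> int" where
  "carrier_coord r = \<lfloor>r / 2\<rfloor> + \<lceil>r / 2\<rceil>"

text \<open>A closed cubical cell is named by its centre \<open>q\<close>: coordinates with \<open>q i\<close> even are fixed, and those with \<open>q i\<close> odd range
over an interval of length \<open>2\<close>. With this naming the antipodal cell has the negated name, and the dimension is the number of odd entries.\<close>

definition cell :: "(nat \<Rightarrow> int) \<Rightarrow> (nat \<Rightarrow> real) set" where
  "cell q = {x. \<forall>i. if odd (q i) then \<bar>x i - q i\<bar> \<le> 1 else x i = q i}"

definition free_coords :: "(nat \<Rightarrow> int) \<Rightarrow> nat set" where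
  "free_coords q = {i. odd (q i)}"

definition cell_boundary :: "(nat \<Rightarrow> int) \<Rightarrow> (nat \<Rightarrow> real) set" where
  "cell_boundary q = {x \<in> cell q. \<exists>i. odd (q i) \<and> \<bar>x i - q i\<bar> = 1}"

definition carrier_cell :: "(nat \<Rightarrow> real) \<Rightarrow> nat \<Rightarrow> int" where
  "carrier_cell x = (\<lambda>i. carrier_coord (x i))"

lemma carrier_coord_cases:
  obtains k where "r = 2 * of_int k" "carrier_coord r = 2 * k"
  | k where "2 * of_int k < r" "r < 2 * of_int k + 2" "carrier_coord r = 2 * k + 1"
proof (cases "\<exists>k. r = 2 * of_int k")
  case True
  then show ?thesis using that(1) by (force simp: carrier_coord_def)
next
  case False
  define k where "k = \<lfloor>r / 2\<rfloor>"
  have k: "of_int k \<le> r / 2" "r / 2 < of_int k + 1" unfolding k_def by linarith+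
  moreover have "of_int k \<noteq> r / 2"
  proof
    assume "of_int k = r / 2"
    then have "r = 2 * of_int k" by linarith
    then show False using False by blast
  qed
  ultimately have "2 * of_int k < r" "r < 2 * of_int k + 2" by linarith+
  moreover from this have "\<lceil>r / 2\<rceil> = k + 1" by (intro ceiling_unique) auto
  ultimately show ?thesis using that(2) by (simp add: carrier_coord_def flip: k_def)
qed

lemma carrier_coord_even: "even (carrier_coord r) \<Longrightarrow> of_int (carrier_coord r) = r"
  by (cases r rule: carrier_coord_cases) auto

lemma carrier_coord_close: "\<bar>r - of_int (carrier_coord r)\<bar> < 1"
  by (cases r rule: carrier_coord_cases) auto

lemma carrier_coord_of_even: "even q \<Longrightarrow> carrier_coord (of_int q) = q"
  by (cases "real_of_int q" rule: carrier_coord_cases) (auto elim!: evenE)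

lemma carrier_coord_of_odd:
  assumes "odd q" "\<bar>r - of_int q\<bar> < 1"
  shows "carrier_coord r = q"
proof -
  obtain j where j: "q = 2 * j + 1" using assms(1) by (auto elim: oddE)
  show ?thesis using assms(2) by (cases r rule: carrier_coord_cases) (auto simp: j)
qed

lemma carrier_coord_at_end:
  assumes "odd q" "\<bar>r - of_int q\<bar> = 1"
  shows "even (carrier_coord r)"
proof -
  have "r = of_int (q + 1) \<or> r = of_int (q - 1)" using assms(2) by auto
  then show ?thesis using assms(1) carrier_coord_of_even[of "q + 1"] carrier_coord_of_even[of "q - 1"]
    by auto
qed

lemma carrier_coord_minus: "carrier_coord (- r) = - carrier_coord r"
  by (simp add: carrier_coord_def ceiling_def)

lemma in_carrier_cell: "x \<in> cell (carrier_cell x)"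
  by (simp add: cell_def carrier_cell_def carrier_coord_even less_imp_le[OF carrier_coord_close])

text \<open>Passing from a cell to the carrier of one of its points only turns some free coordinates into fixed ones, which is to say that
carriers are faces.\<close>

lemma carrier_cell_coord_in_cell:
  assumes "x \<in> cell q"
  shows "carrier_cell x i = q i \<or> odd (q i) \<and> \<bar>x i - q i\<bar> = 1 \<and> even (carrier_cell x i)"
proof -
  have "if odd (q i) then \<bar>x i - q i\<bar> \<le> 1 else x i = q i" using assms by (simp add: cell_def)
  then consider "odd (q i)" "\<bar>x i - q i\<bar> < 1" | "odd (q i)" "\<bar>x i - q i\<bar> = 1" | "even (q i)" "x i = q i"
    by (auto split: if_splits simp: less_le)
  then show ?thesis
    by cases (auto simp: carrier_cell_def carrier_coord_of_odd carrier_coord_of_even intro: carrier_coord_at_end)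
qed

lemma cell_carrier_subset:
  assumes "x \<in> cell q"
  shows "cell (carrier_cell x) \<subseteq> cell q"
proof
  fix y assume y: "y \<in> cell (carrier_cell x)"
  have "if odd (q i) then \<bar>y i - q i\<bar> \<le> 1 else y i = q i" for i
  proof -
    have yi: "if odd (carrier_cell x i) then \<bar>y i - carrier_cell x i\<bar> \<le> 1 else y i = carrier_cell x i"
      using y by (simp add: cell_def)
    consider "carrier_cell x i = q i" | "odd (q i)" "\<bar>x i - q i\<bar> = 1" "even (carrier_cell x i)"
      using carrier_cell_coord_in_cell[OF assms] by blast
    then show ?thesis
    proof cases
      case 2
      then have "y i = x i" using yi carrier_coord_even by (simp add: carrier_cell_def)
      then show ?thesis using 2 by simp
    qed (use yi in \<open>auto split: if_splits\<close>)
  qed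
  then show "y \<in> cell q" by (simp add: cell_def)
qed

lemma carrier_cell_interior: "x \<in> cell q \<Longrightarrow> x \<notin> cell_boundary q \<Longrightarrow> carrier_cell x = q"
  using carrier_cell_coord_in_cell[of x q] by (auto simp: cell_boundary_def)

lemma free_coords_carrier_boundary:
  assumes "x \<in> cell_boundary q"
  shows "free_coords (carrier_cell x) \<subset> free_coords q"
proof -
  have x: "x \<in> cell q" using assms by (simp add: cell_boundary_def)
  obtain i where i: "odd (q i)" "\<bar>x i - q i\<bar> = 1" using assms by (auto simp: cell_boundary_def)
  have "even (carrier_cell x i)" using i by (auto simp: carrier_cell_def carrier_coord_at_end)
  then have "i \<in> free_coords q - free_coords (carrier_cell x)" using i(1) by (simp add: free_coords_def)
  moreover have "free_coords (carrier_cell x) \<subseteq> free_coords q"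
  proof
    fix j assume "j \<in> free_coords (carrier_cell x)"
    then show "j \<in> free_coords q"
      using carrier_cell_coord_in_cell[OF x, of j] by (auto simp: free_coords_def)
  qed
  ultimately show ?thesis by blast
qed

lemma carrier_cell_minus: "carrier_cell (\<lambda>i. - x i) = (\<lambda>i. - carrier_cell x i)"
  by (simp add: carrier_cell_def carrier_coord_minus)

lemma free_coords_minus [simp]: "free_coords (\<lambda>i. - q i) = free_coords q"
  by (simp add: free_coords_def)

lemma cell_minus: "(\<lambda>i. - x i) \<in> cell (\<lambda>i. - q i) \<longleftrightarrow> x \<in> cell q"
proof -
  have "\<bar>- x i - real_of_int (- q i)\<bar> = \<bar>x i - real_of_int (q i)\<bar>" for i by linarith
  then show ?thesis unfolding cell_def mem_Collect_eq by (simp only: even_minus of_int_minus neg_equal_iff_equal)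
qed

lemma cell_boundary_minus: "(\<lambda>i. - x i) \<in> cell_boundary (\<lambda>i. - q i) \<longleftrightarrow> x \<in> cell_boundary q"
proof -
  have "\<bar>- x i - real_of_int (- q i)\<bar> = \<bar>x i - real_of_int (q i)\<bar>" for i by linarith
  then show ?thesis unfolding cell_boundary_def mem_Collect_eq cell_minus by (simp only: even_minus)
qed

lemma closed_cell: "closed (cell q)"
  unfolding cell_def
proof (rule closed_Collect_all)
  show "closed {x. if odd (q i) then \<bar>x i - real_of_int (q i)\<bar> \<le> 1 else x i = real_of_int (q i)}" for i
    by (cases "odd (q i)") (auto intro!: closed_Collect_le closed_Collect_eq continuous_intros)
qed

lemma compact_sphere_set: "compact (sphere_set n)"
proof -
  have "compactin (powertop_real UNIV) (PiE UNIV (\<lambda>i::nat. {-1..1}))"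
    by (subst compactin_PiE) auto
  then have "compact {x::nat \<Rightarrow> real. \<forall>i. x i \<in> {-1..1}}"
    by (simp add: euclidean_product_topology PiE_def Pi_def extensional_def)
  moreover have "closed (sphere_set n)"
    by (intro closed_Collect_conj closed_Collect_all closed_Collect_imp closed_Collect_eq continuous_intros
        open_Collect_const)
  moreover have "sphere_set n \<subseteq> {x. \<forall>i. x i \<in> {-1..1}}"
  proof (clarsimp)
    fix x :: "nat \<Rightarrow> real" and i
    assume s: "(\<Sum>i\<le>n. (x i)\<^sup>2) = 1" "\<forall>i>n. x i = 0"
    show "- 1 \<le> x i \<and> x i \<le> 1"
    proof (cases "i \<le> n")
      case True
      then have "(x i)\<^sup>2 \<le> 1" using s(1) member_le_sum[of i "{..n}" "\<lambda>i. (x i)\<^sup>2"] by simp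
      then have "\<bar>x i\<bar> \<le> 1" by (simp add: abs_square_le_1)
      then show ?thesis by linarith
    qed (use s in auto)
  qed
  ultimately show ?thesis
    using compact_Int_closed[of "{x. \<forall>i. x i \<in> {-1..1}}" "sphere_set n"] by (simp only: inf.absorb2)
qed

lemma continuous_on_Max:
  fixes f :: "'i \<Rightarrow> 'a::topological_space \<Rightarrow> real"
  assumes "finite I" "I \<noteq> {}" "\<And>i. i \<in> I \<Longrightarrow> continuous_on S (f i)"
  shows "continuous_on S (\<lambda>x. Max ((\<lambda>i. f i x) ` I))"
  using assms
proof (induction I rule: finite_ne_induct)
  case (insert i I)
  then show ?case by (simp add: continuous_on_max)
qed simp

text \<open>The maximum norm on the first \<open>n + 1\<close> coordinates; dividing by it projects a sphere radially to the boundary of a cube.\<close>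

definition max_coord :: "nat \<Rightarrow> (nat \<Rightarrow> real) \<Rightarrow> real" where
  "max_coord n x = Max ((\<lambda>i. \<bar>x i\<bar>) ` {..n})"

lemma continuous_max_coord: "continuous_on S (max_coord n)"
  unfolding max_coord_def by (intro continuous_on_Max continuous_intros) auto

lemma max_coord_ge: "i \<le> n \<Longrightarrow> \<bar>x i\<bar> \<le> max_coord n x"
  by (simp add: max_coord_def)

lemma max_coord_attained: obtains i where "i \<le> n" "\<bar>x i\<bar> = max_coord n x"
proof -
  have "max_coord n x \<in> (\<lambda>i. \<bar>x i\<bar>) ` {..n}" unfolding max_coord_def by (intro Max_in) auto
  then show ?thesis using that by auto
qed

lemma max_coord_nonneg: "0 \<le> max_coord n x"
  using max_coord_ge[of 0 n x] by linarith

lemma max_coord_pos: "x \<in> sphere_set n \<Longrightarrow> 0 < max_coord n x"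
proof (rule ccontr)
  assume x: "x \<in> sphere_set n" and "\<not> 0 < max_coord n x"
  then have "x i = 0" if "i \<le> n" for i using max_coord_ge[OF that, of x] by linarith
  then show False using x by simp
qed

lemma max_coord_scale: "max_coord n (\<lambda>i. c * x i) = \<bar>c\<bar> * max_coord n x"
proof -
  obtain i where i: "i \<le> n" "\<bar>x i\<bar> = max_coord n x" by (rule max_coord_attained)
  obtain j where j: "j \<le> n" "\<bar>c * x j\<bar> = max_coord n (\<lambda>i. c * x i)"
    by (rule max_coord_attained[where x = "\<lambda>i. c * x i"])
  show ?thesis
  proof (rule antisym)
    show "max_coord n (\<lambda>i. c * x i) \<le> \<bar>c\<bar> * max_coord n x"
      using max_coord_ge[OF j(1), of x] by (simp add: abs_mult mult_left_mono flip: j(2))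
    show "\<bar>c\<bar> * max_coord n x \<le> max_coord n (\<lambda>i. c * x i)"
      using max_coord_ge[OF i(1), of "\<lambda>i. c * x i"] by (simp add: abs_mult i(2))
  qed
qed

section \<open>Extending a map over a cell\<close>

text \<open>The cell is the cone over its boundary, with apex at the centre. In the proof, \<open>\<psi>\<close> projects the sphere radially to the boundary of
the cell and \<open>\<Phi>\<close> contracts it to the centre as the parameter \<open>t\<close> runs from \<open>0\<close> to \<open>1\<close>.
Being a continuous surjection from a compact space to a Hausdorff space, \<open>\<Phi>\<close> is a quotient map, and it identifies points
only for \<open>t = 1\<close>. A homotopy from \<open>h \<circ> \<psi>\<close> to a constant map is constant there, so it descends to the cell.\<close>

lemma extend_over_cell:
  fixes h :: "(nat \<Rightarrow> real) \<Rightarrow> 'y::topological_space"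
  assumes dim: "finite (free_coords q)" "card (free_coords q) = Suc k"
    and null: "\<And>f. continuous_map (nsphere k) (top_of_set Y) f \<Longrightarrow>
      \<exists>c. homotopic_with (\<lambda>_. True) (nsphere k) (top_of_set Y) f (\<lambda>_. c)"
    and h: "continuous_on (cell_boundary q) h" "h \<in> cell_boundary q \<rightarrow> Y"
  obtains g where "continuous_on (cell q) g" "g \<in> cell q \<rightarrow> Y" "\<forall>x\<in>cell_boundary q. g x = h x"
proof -
  obtain \<beta> where \<beta>: "bij_betw \<beta> {..k} (free_coords q)"
    using bij_betw_iff_card[of "{..k}" "free_coords q"] dim by auto
  define \<gamma> where "\<gamma> = the_inv_into {..k} \<beta>"
  have \<gamma>\<beta>: "\<gamma> (\<beta> j) = j" if "j \<le> k" for j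
    using \<beta> that by (simp add: \<gamma>_def bij_betw_def the_inv_into_f_f)
  have \<beta>_odd: "odd (q (\<beta> j))" if "j \<le> k" for j
    using \<beta> that by (auto simp: bij_betw_def free_coords_def)
  have \<gamma>: "\<gamma> i \<le> k" "\<beta> (\<gamma> i) = i" if "odd (q i)" for i
  proof -
    have "i \<in> \<beta> ` {..k}" using \<beta> that by (auto simp: bij_betw_def free_coords_def)
    then show "\<gamma> i \<le> k" "\<beta> (\<gamma> i) = i" using \<gamma>\<beta> by auto
  qed
  define \<psi> where "\<psi> s = (\<lambda>i. q i + (if odd (q i) then s (\<gamma> i) / max_coord k s else 0))" for s
  have \<psi>: "\<psi> s \<in> cell_boundary q" if s: "s \<in> sphere_set k" for s
  proof -
    have pos: "max_coord k s > 0" using s by (rule max_coord_pos)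
    obtain j where j: "j \<le> k" "\<bar>s j\<bar> = max_coord k s" by (rule max_coord_attained)
    have "\<bar>s (\<gamma> i) / max_coord k s\<bar> \<le> 1" if "odd (q i)" for i
      using max_coord_ge[OF \<gamma>(1)[OF that], of s] pos by (simp add: abs_divide)
    then have "\<psi> s \<in> cell q" by (simp add: cell_def \<psi>_def)
    moreover have "\<bar>\<psi> s (\<beta> j) - q (\<beta> j)\<bar> = 1"
      using j pos by (simp add: \<psi>_def \<beta>_odd \<gamma>\<beta> abs_divide)
    ultimately show ?thesis using \<beta>_odd[OF j(1)] by (auto simp: cell_boundary_def)
  qed
  have cont_\<psi>: "continuous_on (sphere_set k) \<psi>"
  proof (rule continuous_on_coordinatewise_then_product)
    fix i
    have "\<forall>s\<in>sphere_set k. max_coord k s \<noteq> 0" using max_coord_pos by fastforce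
    then show "continuous_on (sphere_set k) (\<lambda>s. \<psi> s i)"
      unfolding \<psi>_def by (cases "odd (q i)") (auto intro!: continuous_intros continuous_max_coord)
  qed
  define \<Phi> where "\<Phi> = (\<lambda>(t::real, s). (\<lambda>i. q i + (1 - t) * (\<psi> s i - q i)))"
  let ?P = "prod_topology (top_of_set {0..1::real}) (nsphere k)"
  have P: "?P = top_of_set ({0..1} \<times> sphere_set k)"
    by (simp add: nsphere_eq_top_of_set)
  have \<Phi>_cell: "\<Phi> ts \<in> cell q" if ts: "ts \<in> {0..1} \<times> sphere_set k" for ts
  proof -
    obtain t s where [simp]: "ts = (t, s)" by (cases ts)
    have t: "0 \<le> t" "t \<le> 1" and s: "s \<in> sphere_set k" using ts by auto
    have c: "\<psi> s \<in> cell q" using \<psi>[OF s] by (simp add: cell_boundary_def)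
    have "if odd (q i) then \<bar>\<Phi> ts i - q i\<bar> \<le> 1 else \<Phi> ts i = q i" for i
    proof (cases "odd (q i)")
      case True
      then have "\<bar>\<psi> s i - q i\<bar> \<le> 1" using c by (simp add: cell_def)
      then have "\<bar>1 - t\<bar> * \<bar>\<psi> s i - q i\<bar> \<le> 1" using t by (intro mult_le_one) auto
      then show ?thesis using True by (simp add: \<Phi>_def abs_mult)
    next
      case False
      then have "\<psi> s i = q i" by (simp add: \<psi>_def)
      then show ?thesis using False by (simp add: \<Phi>_def)
    qed
    then show ?thesis unfolding cell_def by blast
  qed
  have cont_\<Phi>: "continuous_on ({0..1} \<times> sphere_set k) \<Phi>"
    unfolding \<Phi>_def split_beta
  proof (rule continuous_on_coordinatewise_then_product)
    fix i
    have "continuous_on ({0..1::real} \<times> sphere_set k) (\<lambda>ts. \<psi> (snd ts))"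
      by (rule continuous_on_compose2[OF cont_\<psi> continuous_on_snd[OF continuous_on_id]]) auto
    then have "continuous_on ({0..1::real} \<times> sphere_set k) (\<lambda>ts. \<psi> (snd ts) i)"
      by (rule continuous_on_product_then_coordinatewise)
    then show "continuous_on ({0..1} \<times> sphere_set k)
        (\<lambda>x. real_of_int (q i) + (1 - fst x) * (\<psi> (snd x) i - real_of_int (q i)))"
      by (intro continuous_intros)
  qed
  \<comment> \<open>A point \<open>x\<close> at distance \<open>r\<close> from the centre, in the maximum norm, is reached at the parameter \<open>1 - r\<close>
from the direction of \<open>x - q\<close>.\<close>
  have surj: "\<exists>ts\<in>{0..1} \<times> sphere_set k. \<Phi> ts = x" if x: "x \<in> cell q" for x
  proof -
    define v where "v j = x (\<beta> j) - q (\<beta> j)" for j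
    define r where "r = max_coord k v"
    have xi: "x i = q i" if "even (q i)" for i
      using x that by (simp add: cell_def)
    have xo: "\<bar>x i - q i\<bar> \<le> 1" if "odd (q i)" for i
      using x that by (simp add: cell_def)
    have r01: "0 \<le> r" "r \<le> 1"
    proof -
      show "0 \<le> r" by (simp add: r_def max_coord_nonneg)
      obtain j where "j \<le> k" "\<bar>v j\<bar> = r" unfolding r_def by (rule max_coord_attained)
      then show "r \<le> 1" using xo[OF \<beta>_odd, of j] by (simp add: v_def)
    qed
    show ?thesis
    proof (cases "r = 0")
      case True
      define s :: "nat \<Rightarrow> real" where "s = (\<lambda>i. if i = 0 then 1 else 0)"
      have "(\<Sum>i\<le>k. (s i)\<^sup>2) = (\<Sum>i\<le>k. if i = 0 then 1 else 0)"
        unfolding s_def by (intro sum.cong) auto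
      then have "s \<in> sphere_set k" by (simp add: s_def)
      moreover have "x i = q i" for i
      proof (cases "odd (q i)")
        case odd: True
        have "\<bar>v (\<gamma> i)\<bar> \<le> r" unfolding r_def using \<gamma>(1)[OF odd] by (rule max_coord_ge)
        then show ?thesis using True \<gamma>(2)[OF odd] by (simp add: v_def)
      qed (simp add: xi)
      then have "\<Phi> (1, s) = x" by (auto simp: \<Phi>_def)
      ultimately show ?thesis by force
    next
      case False
      then have r: "r > 0" using r01 by simp
      define l where "l = sqrt (\<Sum>j\<le>k. (v j)\<^sup>2)"
      have "l > 0"
      proof -
        obtain j where j: "j \<le> k" "\<bar>v j\<bar> = r" unfolding r_def by (rule max_coord_attained)
        then have "(\<Sum>j\<le>k. (v j)\<^sup>2) > 0" using r by (intro sum_pos2[where i=j]) auto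
        then show ?thesis by (simp add: l_def)
      qed
      define s where "s = (\<lambda>j. if j \<le> k then v j / l else 0)"
      have "(\<Sum>j\<le>k. (s j)\<^sup>2) = (\<Sum>j\<le>k. (v j)\<^sup>2) / l\<^sup>2"
        by (simp add: s_def power_divide sum_divide_distrib)
      also have "\<dots> = 1" using \<open>l > 0\<close> by (simp add: l_def sum_nonneg)
      finally have s: "s \<in> sphere_set k" by (simp add: s_def)
      have "max_coord k s = max_coord k (\<lambda>j. (1 / l) * v j)"
        unfolding max_coord_def s_def by (intro arg_cong[where f=Max] image_cong) auto
      then have ms: "max_coord k s = r / l"
        using \<open>l > 0\<close> by (simp only: max_coord_scale) (simp add: r_def)
      have "\<Phi> (1 - r, s) i = x i" for i
      proof (cases "odd (q i)")
        case odd: True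
        then have "\<psi> s i - q i = v (\<gamma> i) / r"
          using \<gamma>(1)[OF odd] \<open>l > 0\<close> unfolding \<psi>_def ms by (simp add: s_def)
        then show ?thesis using r \<gamma>(2)[OF odd] by (simp add: \<Phi>_def v_def)
      qed (simp add: \<Phi>_def \<psi>_def xi)
      then have "\<Phi> (1 - r, s) = x" by blast
      moreover have "1 - r \<in> {0..1}" using r01 by simp
      ultimately show ?thesis using s by (intro bexI[of _ "(1 - r, s)"]) blast+
    qed
  qed
  \<comment> \<open>Comparing maximum norms recovers \<open>t\<close>; for \<open>t \<noteq> 1\<close> the two points of the sphere are then positive multiples of
each other, hence equal.\<close>
  have inj: "t = t' \<and> (t = 1 \<or> s = s')"
    if "\<Phi> (t, s) = \<Phi> (t', s')" "t \<le> 1" "t' \<le> 1" and s: "s \<in> sphere_set k" "s' \<in> sphere_set k"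
    for t t' s s'
  proof -
    define M M' where "M = max_coord k s" and "M' = max_coord k s'"
    have M: "M > 0" "M' > 0" using s by (simp_all only: M_def M'_def max_coord_pos)
    have eq: "(1 - t) / M * s j = (1 - t') / M' * s' j" if "j \<le> k" for j
      using fun_cong[OF \<open>\<Phi> (t, s) = \<Phi> (t', s')\<close>, of "\<beta> j"] that
      by (simp add: \<Phi>_def \<psi>_def \<beta>_odd \<gamma>\<beta> M_def M'_def)
    have "max_coord k (\<lambda>j. (1 - t) / M * s j) = max_coord k (\<lambda>j. (1 - t') / M' * s' j)"
      unfolding max_coord_def by (intro arg_cong[where f=Max] image_cong) (simp_all only: eq atMost_iff)
    then have "\<bar>(1 - t) / M\<bar> * M = \<bar>(1 - t') / M'\<bar> * M'"
      by (simp only: max_coord_scale M_def M'_def)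
    then have tt: "t = t'" using M that(2,3) by simp
    moreover have "s = s'" if "t \<noteq> 1"
    proof -
      define c where "c = M / M'"
      have "c > 0" using M by (simp add: c_def)
      have sj: "s j = c * s' j" for j
      proof (cases "j \<le> k")
        case True
        then have "(1 - t') * (s j / M) = (1 - t') * (s' j / M')" using eq[OF True] tt by simp
        then have "s j / M = s' j / M'" using that unfolding tt by (subst (asm) mult_left_cancel) auto
        then show ?thesis using M by (simp add: c_def field_simps)
      qed (use s in simp)
      have "1 = (\<Sum>j\<le>k. (s j)\<^sup>2)" using s by simp
      also have "\<dots> = c\<^sup>2 * (\<Sum>j\<le>k. (s' j)\<^sup>2)" by (simp add: sj power_mult_distrib sum_distrib_left)
      also have "\<dots> = c\<^sup>2" using s by simp
      finally have "c = 1" using \<open>c > 0\<close> by (simp add: power2_eq_1_iff)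
      then show ?thesis using sj by auto
    qed
    ultimately show ?thesis by blast
  qed
  have "continuous_on (sphere_set k) (h \<circ> \<psi>)"
    using h(1) \<psi> by (intro continuous_on_compose cont_\<psi>) (auto intro: continuous_on_subset)
  then have "continuous_map (nsphere k) (top_of_set Y) (h \<circ> \<psi>)"
    using h(2) \<psi> by (auto simp: nsphere_eq_top_of_set)
  from null[OF this] obtain c where
    "homotopic_with (\<lambda>_. True) (nsphere k) (top_of_set Y) (h \<circ> \<psi>) (\<lambda>_. c)" ..
  then obtain H :: "real \<times> (nat \<Rightarrow> real) \<Rightarrow> 'y" where H: "continuous_map ?P (top_of_set Y) H"
    and H0: "\<forall>s. H (0, s) = h (\<psi> s)" and H1: "\<forall>s. H (1, s) = c"
    unfolding homotopic_with_def comp_apply by blast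
  have "quotient_map ?P (top_of_set (cell q)) \<Phi>"
  proof (rule continuous_closed_imp_quotient_map)
    show cm: "continuous_map ?P (top_of_set (cell q)) \<Phi>"
      using cont_\<Phi> \<Phi>_cell unfolding P by auto
    have "compact_space ?P"
      unfolding P using compact_Times[OF compact_Icc compact_sphere_set]
      by (intro compact_space_subtopology) (simp only: compactin_euclidean_iff)
    moreover have "Hausdorff_space (top_of_set (cell q))" by (simp add: Hausdorff_space_subtopology)
    ultimately show "closed_map ?P (top_of_set (cell q)) \<Phi>"
      using cm by (intro continuous_imp_closed_map) 
    show "\<Phi> ` topspace ?P = topspace (top_of_set (cell q))"
      using surj \<Phi>_cell unfolding P by fastforce
  qed
  then obtain g where g: "continuous_map (top_of_set (cell q)) (top_of_set Y) g"
    and g\<Phi>: "\<forall>ts\<in>topspace ?P. g (\<Phi> ts) = H ts"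
  proof (rule quotient_map_lift_exists[OF _ H])
    fix x y assume xy: "x \<in> topspace ?P" "y \<in> topspace ?P" "\<Phi> x = \<Phi> y"
    obtain t s t' s' where [simp]: "x = (t, s)" "y = (t', s')" by (cases x, cases y)
    have "t = t' \<and> (t = 1 \<or> s = s')"
      using xy unfolding P by (intro inj) auto
    then show "H x = H y" using H1 by auto
  next
    fix g assume "continuous_map (top_of_set (cell q)) (top_of_set Y) g"
      and "\<And>x. x \<in> topspace ?P \<Longrightarrow> g (\<Phi> x) = H x"
    then show thesis by (intro that) blast+
  qed
  show thesis
  proof
    show "continuous_on (cell q) g" "g \<in> cell q \<rightarrow> Y" using g by auto
    show "\<forall>x\<in>cell_boundary q. g x = h x"
    proof
      fix x assume x: "x \<in> cell_boundary q"
      then have "x \<in> cell q" by (simp add: cell_boundary_def)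
      then obtain t s where ts: "t \<in> {0..1}" "s \<in> sphere_set k" "\<Phi> (t, s) = x"
        using surj by blast
      obtain i where i: "odd (q i)" "\<bar>x i - q i\<bar> = 1" using x by (auto simp: cell_boundary_def)
      have "\<bar>\<psi> s i - q i\<bar> \<le> 1" using \<psi>[OF ts(2)] i(1) by (auto simp: cell_boundary_def cell_def)
      moreover have "(1 - t) * \<bar>\<psi> s i - q i\<bar> = 1"
        using i(2) ts by (auto simp: \<Phi>_def abs_mult)
      ultimately have "1 \<le> 1 - t" using ts(1)
        by (metis atLeastAtMost_iff diff_ge_0_iff_ge mult.right_neutral mult_left_mono)
      then have "t = 0" using ts(1) by auto
      then have "x = \<psi> s" using ts(3) by (auto simp: \<Phi>_def)
      moreover have "(0, s) \<in> topspace ?P" unfolding P using ts(2) by simp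
      ultimately show "g x = h x" using bspec[OF g\<Phi>, of "(0, s)"] ts(3) \<open>t = 0\<close> H0 by simp
    qed
  qed
qed

section \<open>Equivariant maps on the boundary of a cube\<close>

definition cube_boundary :: "nat \<Rightarrow> nat \<Rightarrow> (nat \<Rightarrow> real) set" where
  "cube_boundary n N = {x. (\<forall>i\<le>n. \<bar>x i\<bar> \<le> 2 * real N) \<and> (\<exists>i\<le>n. \<bar>x i\<bar> = 2 * real N) \<and> (\<forall>i>n. x i = 0)}"

definition cube_cells :: "nat \<Rightarrow> nat \<Rightarrow> (nat \<Rightarrow> int) set" where
  "cube_cells n N = {q. (\<forall>i\<le>n. \<bar>q i\<bar> \<le> 2 * int N) \<and> (\<exists>i\<le>n. \<bar>q i\<bar> = 2 * int N) \<and> (\<forall>i>n. q i = 0)}"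

lemma carrier_coord_bounds:
  "\<bar>r\<bar> \<le> 2 * real N \<Longrightarrow> \<bar>carrier_coord r\<bar> \<le> 2 * int N"
  "\<bar>r\<bar> = 2 * real N \<Longrightarrow> \<bar>carrier_coord r\<bar> = 2 * int N"
proof -
  assume r: "\<bar>r\<bar> \<le> 2 * real N"
  show "\<bar>carrier_coord r\<bar> \<le> 2 * int N"
    using r by (cases r rule: carrier_coord_cases) linarith+
next
  assume r: "\<bar>r\<bar> = 2 * real N"
  then have "r = of_int (2 * int N) \<or> r = of_int (- (2 * int N))" by auto
  then show "\<bar>carrier_coord r\<bar> = 2 * int N"
    using carrier_coord_of_even[of "2 * int N"] carrier_coord_of_even[of "- (2 * int N)"] by auto
qed

lemma carrier_cell_cube: "x \<in> cube_boundary n N \<Longrightarrow> carrier_cell x \<in> cube_cells n N"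
  using carrier_coord_bounds carrier_coord_of_even[of 0]
  by (auto simp: cube_boundary_def cube_cells_def carrier_cell_def)

lemma cell_subset_cube_boundary:
  assumes q: "q \<in> cube_cells n N"
  shows "cell q \<subseteq> cube_boundary n N"
proof
  fix x assume "x \<in> cell q"
  then have x: "if odd (q i) then \<bar>x i - q i\<bar> \<le> 1 else x i = q i" for i
    by (simp add: cell_def)
  have "\<bar>x i\<bar> \<le> 2 * real N" if "i \<le> n" for i
  proof -
    have qi: "\<bar>q i\<bar> \<le> 2 * int N" using q that by (simp add: cube_cells_def)
    show ?thesis
    proof (cases "odd (q i)")
      case True
      then have "\<bar>q i\<bar> \<noteq> 2 * int N" by (metis dvd_abs_iff dvd_triv_left)
      then have "\<bar>q i\<bar> \<le> 2 * int N - 1" using qi by linarith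
      then have "\<bar>real_of_int (q i)\<bar> \<le> 2 * real N - 1" by linarith
      then show ?thesis using x[of i] True by auto
    next
      case False
      then show ?thesis using x[of i] qi by auto
    qed
  qed
  moreover obtain i where i: "i \<le> n" "\<bar>q i\<bar> = 2 * int N" using q by (auto simp: cube_cells_def)
  then have "even (q i)" by (metis dvd_abs_iff dvd_triv_left)
  then have "\<bar>x i\<bar> = 2 * real N" using x[of i] i(2) by simp
  moreover have "x i = 0" if "i > n" for i
    using x[of i] q that by (simp add: cube_cells_def)
  ultimately show "x \<in> cube_boundary n N" using i(1) by (auto simp: cube_boundary_def)
qed

lemma finite_cube_cells: "finite (cube_cells n N)"
proof (rule finite_subset)
  show "cube_cells n N \<subseteq> {q. \<forall>i. (i \<in> {..n} \<longrightarrow> q i \<in> {- (2 * int N)..2 * int N}) \<and> (i \<notin> {..n} \<longrightarrow> q i = 0)}"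
    by (auto simp: cube_cells_def)
  show "finite {q. \<forall>i. (i \<in> {..n} \<longrightarrow> q i \<in> {- (2 * int N)..2 * int N}) \<and> (i \<notin> {..n} \<longrightarrow> q i = 0)}"
    by (rule finite_set_of_finite_funs) auto
qed

text \<open>A coordinate with absolute value \<open>2 * N\<close> is even and thus fixed, so cells in the boundary of the cube have dimension
at most \<open>n\<close>, although there are \<open>n + 1\<close> coordinates.\<close>

lemma free_coords_cube:
  assumes "q \<in> cube_cells n N"
  shows "finite (free_coords q)" "card (free_coords q) \<le> n"
proof -
  obtain i where i: "i \<le> n" "\<bar>q i\<bar> = 2 * int N" using assms by (auto simp: cube_cells_def)
  then have "even (q i)" by (metis dvd_abs_iff dvd_triv_left)
  then have sub: "free_coords q \<subseteq> {..n} - {i}"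
    using assms by (auto simp: free_coords_def cube_cells_def) (metis even_zero not_le)
  then show "finite (free_coords q)" by (rule finite_subset) simp
  show "card (free_coords q) \<le> n" using card_mono[OF _ sub] i(1) by simp
qed

lemma cube_cells_minus: "q \<in> cube_cells n N \<Longrightarrow> (\<lambda>i. - q i) \<in> cube_cells n N"
  by (simp add: cube_cells_def)

text \<open>The strict inequality makes the skeleton empty for \<open>k = 0\<close>, where the induction starts.\<close>

definition skeleton :: "nat \<Rightarrow> nat \<Rightarrow> nat \<Rightarrow> (nat \<Rightarrow> real) set" where
  "skeleton n N k = {x \<in> cube_boundary n N. card (free_coords (carrier_cell x)) < k}"

lemma skeleton_eq: "skeleton n N k = (\<Union>q\<in>{q \<in> cube_cells n N. card (free_coords q) < k}. cell q)"
proof (intro equalityI subsetI)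
  fix x assume "x \<in> skeleton n N k"
  then show "x \<in> (\<Union>q\<in>{q \<in> cube_cells n N. card (free_coords q) < k}. cell q)"
    by (intro UN_I[of "carrier_cell x"]) (auto simp: skeleton_def carrier_cell_cube in_carrier_cell)
next
  fix x assume "x \<in> (\<Union>q\<in>{q \<in> cube_cells n N. card (free_coords q) < k}. cell q)"
  then obtain q where q: "q \<in> cube_cells n N" "card (free_coords q) < k" "x \<in> cell q" by blast
  have "free_coords (carrier_cell x) \<subseteq> free_coords q"
    using free_coords_carrier_boundary[of x q] carrier_cell_interior[OF q(3)] by blast
  then have "card (free_coords (carrier_cell x)) < k"
    using card_mono[OF free_coords_cube(1)[OF q(1)]] q(2) by (meson le_less_trans)
  then show "x \<in> skeleton n N k"
    using cell_subset_cube_boundary[OF q(1)] q(3) by (auto simp: skeleton_def)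
qed

lemma cube_boundary_minus: "x \<in> cube_boundary n N \<Longrightarrow> (\<lambda>i. - x i) \<in> cube_boundary n N"
  by (simp add: cube_boundary_def)

lemma skeleton_minus: "x \<in> skeleton n N k \<Longrightarrow> (\<lambda>i. - x i) \<in> skeleton n N k"
  by (simp add: skeleton_def cube_boundary_minus carrier_cell_minus)

lemma closed_skeleton: "closed (skeleton n N k)"
  unfolding skeleton_eq by (intro closed_UN) (auto simp: finite_cube_cells closed_cell)

text \<open>The sign of the first nonzero entry selects one cell of each antipodal pair.\<close>

definition positive_cell :: "(nat \<Rightarrow> int) \<Rightarrow> bool" where
  "positive_cell q \<longleftrightarrow> 0 < q (LEAST i. q i \<noteq> 0)"

lemma positive_cell_minus:
  assumes "q \<in> cube_cells n N" "N > 0"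
  shows "positive_cell (\<lambda>i. - q i) \<longleftrightarrow> \<not> positive_cell q"
proof -
  obtain i where "\<bar>q i\<bar> = 2 * int N" using assms by (auto simp: cube_cells_def)
  then have "q i \<noteq> 0" using \<open>N > 0\<close> by auto
  then have "q (LEAST i. q i \<noteq> 0) \<noteq> 0" by (rule LeastI)
  then show ?thesis by (auto simp: positive_cell_def)
qed

text \<open>Suppose that the map is constructed on the cells of dimension less than \<open>k\<close>. By monotonicity of \<open>Y\<close>, it sends the boundary of a
\<open>k\<close>-dimensional cell \<open>q\<close> into \<open>Y q\<close>, and since \<open>k - 1 \<le> n - 1\<close>, connectivity gives an extension over \<open>q\<close>. The
extension is used when \<open>q\<close> is positive and is transported by \<open>\<nu>\<close> to the antipodal cell. Two antipodal cells have different
names, so these choices do not interfere, and on common boundaries they agree by equivariance of what is already constructed.\<close>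

theorem equivariant_map_carried_by_cells:
  fixes Y :: "(nat \<Rightarrow> int) \<Rightarrow> 'y::topological_space set"
  assumes "N > 0" "n > 0"
    and mono: "\<And>q x. q \<in> cube_cells n N \<Longrightarrow> x \<in> cell q \<Longrightarrow> Y (carrier_cell x) \<subseteq> Y q"
    and conn: "\<And>q. q \<in> cube_cells n N \<Longrightarrow> n_connected_space (n - 1) (top_of_set (Y q))"
    and \<nu>: "continuous_on UNIV \<nu>" "\<And>y. \<nu> (\<nu> y) = y"
      "\<And>q. q \<in> cube_cells n N \<Longrightarrow> \<nu> ` Y q \<subseteq> Y (\<lambda>i. - q i)"
  obtains g where "continuous_on (cube_boundary n N) g"
    "\<forall>x\<in>cube_boundary n N. g (\<lambda>i. - x i) = \<nu> (g x)"
    "\<forall>x\<in>cube_boundary n N. g x \<in> Y (carrier_cell x)"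
proof -
  have "\<exists>g. continuous_on (skeleton n N k) g \<and> (\<forall>x\<in>skeleton n N k. g (\<lambda>i. - x i) = \<nu> (g x)) \<and>
      (\<forall>x\<in>skeleton n N k. g x \<in> Y (carrier_cell x))" for k
  proof (induction k)
    case 0
    then show ?case by (simp add: skeleton_def)
  next
    case (Suc k)
    then obtain g where g: "continuous_on (skeleton n N k) g"
      "\<forall>x\<in>skeleton n N k. g (\<lambda>i. - x i) = \<nu> (g x)"
      "\<forall>x\<in>skeleton n N k. g x \<in> Y (carrier_cell x)" by blast
    define Q where "Q = {q \<in> cube_cells n N. card (free_coords q) = k}"
    have bd: "cell_boundary q \<subseteq> skeleton n N k" if "q \<in> Q" for q
    proof
      fix x assume x: "x \<in> cell_boundary q"
      have q: "q \<in> cube_cells n N" "card (free_coords q) = k" using that by (auto simp: Q_def)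
      have "x \<in> cube_boundary n N"
        using x cell_subset_cube_boundary[OF q(1)] by (auto simp: cell_boundary_def)
      then show "x \<in> skeleton n N k"
        using psubset_card_mono[OF free_coords_cube(1)[OF q(1)] free_coords_carrier_boundary[OF x]] q(2)
        by (simp add: skeleton_def)
    qed
    have "\<exists>h. continuous_on (cell q) h \<and> h \<in> cell q \<rightarrow> Y q \<and> (\<forall>x\<in>cell_boundary q. h x = g x)"
      if q: "q \<in> Q" for q
    proof -
      have qc: "q \<in> cube_cells n N" "card (free_coords q) = k" using q by (auto simp: Q_def)
      note fin = free_coords_cube[OF qc(1)]
      show ?thesis
      proof (cases k)
        case 0
        then have "cell_boundary q = {}" using fin qc(2) by (auto simp: free_coords_def cell_boundary_def)
        moreover obtain y where "y \<in> Y q"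
          using conn[OF qc(1)] by (auto simp: n_connected_space_def)
        ultimately show ?thesis by (intro exI[of _ "\<lambda>_. y"]) auto
      next
        case (Suc j)
        have "g \<in> cell_boundary q \<rightarrow> Y q"
        proof
          fix x assume x: "x \<in> cell_boundary q"
          then have "g x \<in> Y (carrier_cell x)" using bd[OF q] g(3) by blast
          moreover have "x \<in> cell q" using x by (simp add: cell_boundary_def)
          ultimately show "g x \<in> Y q" using mono[OF qc(1)] by blast
        qed
        moreover have "continuous_on (cell_boundary q) g"
          using g(1) bd[OF q] by (rule continuous_on_subset)
        moreover have "\<exists>c. homotopic_with (\<lambda>_. True) (nsphere j) (top_of_set (Y q)) f (\<lambda>_. c)"
          if "continuous_map (nsphere j) (top_of_set (Y q)) f" for f
        proof -
          have "j \<le> n - 1" using Suc fin(2) qc(2) by simp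
          then show ?thesis using conn[OF qc(1)] that unfolding n_connected_space_def by blast
        qed
        moreover have "card (free_coords q) = Suc j" using qc(2) Suc by simp
        ultimately obtain h where "continuous_on (cell q) h" "h \<in> cell q \<rightarrow> Y q" "\<forall>x\<in>cell_boundary q. h x = g x"
          using extend_over_cell[OF fin(1), of j "Y q" g] by metis
        then show ?thesis by blast
      qed
    qed
    then obtain h where h: "\<forall>q\<in>Q. continuous_on (cell q) (h q) \<and> h q \<in> cell q \<rightarrow> Y q \<and>
        (\<forall>x\<in>cell_boundary q. h q x = g x)"
      by metis
    define G where "G q x = (if positive_cell q then h q x else \<nu> (h (\<lambda>i. - q i) (\<lambda>i. - x i)))" for q x
    have Q_minus: "(\<lambda>i. - q i) \<in> Q" if "q \<in> Q" for q
      using that by (simp add: Q_def cube_cells_minus)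
    have G: "continuous_on (cell q) (G q)" "\<And>x. x \<in> cell q \<Longrightarrow> G q x \<in> Y q"
      "\<And>x. x \<in> cell_boundary q \<Longrightarrow> G q x = g x"
      "\<And>x. G (\<lambda>i. - q i) (\<lambda>i. - x i) = \<nu> (G q x)"
      if q: "q \<in> Q" for q
    proof -
      have qc: "q \<in> cube_cells n N" using q by (auto simp: Q_def)
      note mq = bspec[OF h Q_minus[OF q]] and hq = bspec[OF h q]
      have neg: "continuous_on (cell q) (\<lambda>x i. - x i)"
        by (intro continuous_on_coordinatewise_then_product continuous_intros)
      have im: "(\<lambda>x i. - x i) ` cell q \<subseteq> cell (\<lambda>i. - q i)" by (auto simp: cell_minus)
      have "continuous_on (cell q) (\<lambda>x. h (\<lambda>i. - q i) (\<lambda>i. - x i))"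
        using mq by (intro continuous_on_compose2[OF _ neg im]) blast
      then have "continuous_on (cell q) (\<lambda>x. \<nu> (h (\<lambda>i. - q i) (\<lambda>i. - x i)))"
        by (rule continuous_on_compose2[OF \<nu>(1)]) simp
      then show "continuous_on (cell q) (G q)"
        using hq unfolding G_def by (cases "positive_cell q") auto
      show "G q x \<in> Y q" if "x \<in> cell q" for x
      proof -
        have "(\<lambda>i. - x i) \<in> cell (\<lambda>i. - q i)" using that by (simp add: cell_minus)
        then have "h (\<lambda>i. - q i) (\<lambda>i. - x i) \<in> Y (\<lambda>i. - q i)" using mq by blast
        then have "\<nu> (h (\<lambda>i. - q i) (\<lambda>i. - x i)) \<in> Y q"
          using \<nu>(3)[OF cube_cells_minus[OF qc]] by auto
        then show ?thesis using hq that by (auto simp: G_def)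
      qed
      show "G q x = g x" if x: "x \<in> cell_boundary q" for x
      proof -
        have "(\<lambda>i. - x i) \<in> cell_boundary (\<lambda>i. - q i)" using x by (simp add: cell_boundary_minus)
        then have "h (\<lambda>i. - q i) (\<lambda>i. - x i) = g (\<lambda>i. - x i)" using mq by blast
        also have "\<dots> = \<nu> (g x)" using g(2) bd[OF q] x by blast
        finally show ?thesis using hq x by (simp add: G_def \<nu>(2))
      qed
      show "G (\<lambda>i. - q i) (\<lambda>i. - x i) = \<nu> (G q x)" for x
        using positive_cell_minus[OF qc \<open>N > 0\<close>] by (simp add: G_def \<nu>(2))
    qed
    define g' where "g' x = (if x \<in> skeleton n N k then g x else G (carrier_cell x) x)" for x
    have new: "carrier_cell x \<in> Q" if "x \<in> skeleton n N (Suc k)" "x \<notin> skeleton n N k" for x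
      using that by (auto simp: skeleton_def Q_def carrier_cell_cube)
    have g'_cell: "g' x = G q x" if q: "q \<in> Q" and x: "x \<in> cell q" for q x
    proof (cases "x \<in> cell_boundary q")
      case True
      then show ?thesis using bd[OF q] G(3)[OF q] by (auto simp: g'_def)
    next
      case False
      then have "carrier_cell x = q" using x by (intro carrier_cell_interior)
      moreover from this have "x \<notin> skeleton n N k" using q by (simp add: skeleton_def Q_def)
      ultimately show ?thesis by (simp add: g'_def)
    qed
    have skel: "skeleton n N (Suc k) = skeleton n N k \<union> (\<Union>q\<in>Q. cell q)"
      unfolding skeleton_eq Q_def by (auto simp: less_Suc_eq)
    show ?case
    proof (intro exI conjI ballI)
      show "continuous_on (skeleton n N (Suc k)) g'"
        unfolding skel
      proof (rule continuous_on_closed_Un)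
        have "finite Q" unfolding Q_def using finite_cube_cells by simp
        then show "closed (\<Union>q\<in>Q. cell q)" by (intro closed_UN) (auto simp: closed_cell)
        show "continuous_on (skeleton n N k) g'"
          using g(1) by (simp add: g'_def cong: continuous_on_cong_simp)
        have "continuous_on (cell q) g'" if "q \<in> Q" for q
          using G(1)[OF that] by (rule continuous_on_eq) (simp add: g'_cell[OF that])
        then show "continuous_on (\<Union>q\<in>Q. cell q) g'"
          using \<open>finite Q\<close> by (intro continuous_on_closed_Union) (auto simp: closed_cell)
      qed (rule closed_skeleton)
      fix x assume x: "x \<in> skeleton n N (Suc k)"
      show "g' (\<lambda>i. - x i) = \<nu> (g' x)"
      proof (cases "x \<in> skeleton n N k")
        case True
        then show ?thesis using g(2) skeleton_minus by (simp add: g'_def)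
      next
        case False
        have q: "carrier_cell x \<in> Q" using new[OF x False] .
        have "g' (\<lambda>i. - x i) = G (\<lambda>i. - carrier_cell x i) (\<lambda>i. - x i)"
          by (rule g'_cell[OF Q_minus[OF q]]) (simp add: cell_minus in_carrier_cell)
        then show ?thesis using False by (simp add: G(4)[OF q] g'_def)
      qed
      show "g' x \<in> Y (carrier_cell x)"
        using g(3) G(2)[OF new[OF x] in_carrier_cell] by (simp add: g'_def)
    qed
  qed
  moreover have "skeleton n N (Suc n) = cube_boundary n N"
    using free_coords_cube(2)[OF carrier_cell_cube] by (auto simp: skeleton_def less_Suc_eq_le)
  ultimately show thesis using that by metis
qed

text \<open>Radial projection from the sphere to the boundary of the cube is continuous and odd.\<close>

lemma Borsuk_Ulam_cube:
  fixes b :: "nat \<Rightarrow> 'a::euclidean_space" and \<phi> :: "(nat \<Rightarrow> real) \<Rightarrow> nat \<Rightarrow> real"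
  assumes b: "orthonormal_frame b n" and "N > 0"
    and cont: "continuous_on (cube_boundary n N) \<phi>"
    and odd: "\<forall>x\<in>cube_boundary n N. \<phi> (\<lambda>i. - x i) = (\<lambda>i. - \<phi> x i)"
    and low: "\<And>x i. x \<in> cube_boundary n N \<Longrightarrow> i \<ge> n \<Longrightarrow> \<phi> x i = 0"
  shows "\<exists>x\<in>cube_boundary n N. \<phi> x = (\<lambda>_. 0)"
proof -
  define \<rho> where "\<rho> s = (\<lambda>i. s i * (2 * real N / max_coord n s))" for s
  have \<rho>: "\<rho> s \<in> cube_boundary n N" if s: "s \<in> sphere_set n" for s
  proof -
    have pos: "max_coord n s > 0" using s by (rule max_coord_pos)
    obtain j where j: "j \<le> n" "\<bar>s j\<bar> = max_coord n s" by (rule max_coord_attained)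
    have "\<bar>\<rho> s i\<bar> \<le> 2 * real N" if "i \<le> n" for i
    proof -
      have "\<bar>s i\<bar> * (2 * real N / max_coord n s) \<le> max_coord n s * (2 * real N / max_coord n s)"
        using max_coord_ge[OF that, of s] pos by (intro mult_right_mono) auto
      then show ?thesis using pos by (simp add: \<rho>_def abs_mult)
    qed
    moreover have "\<bar>\<rho> s j\<bar> = 2 * real N" using pos j by (simp add: \<rho>_def abs_mult)
    moreover have "\<rho> s i = 0" if "i > n" for i using s that by (simp add: \<rho>_def)
    ultimately show ?thesis using j(1) by (auto simp: cube_boundary_def)
  qed
  have cont_\<rho>: "continuous_on (sphere_set n) \<rho>"
    unfolding \<rho>_def
  proof (rule continuous_on_coordinatewise_then_product)
    have "\<forall>s\<in>sphere_set n. max_coord n s \<noteq> 0" using max_coord_pos by fastforce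
    then show "continuous_on (sphere_set n) (\<lambda>s. s i * (2 * real N / max_coord n s))" for i
      by (intro continuous_intros continuous_max_coord)
  qed
  have "\<exists>s\<in>sphere_set n. (\<phi> \<circ> \<rho>) s = (\<lambda>_. 0)"
  proof (rule Borsuk_Ulam[OF b])
    show "continuous_on (sphere_set n) (\<phi> \<circ> \<rho>)"
      using \<rho> by (intro continuous_on_compose cont_\<rho> continuous_on_subset[OF cont]) blast
    show "\<forall>x\<in>sphere_set n. (\<phi> \<circ> \<rho>) (\<lambda>i. - x i) = (\<lambda>i. - (\<phi> \<circ> \<rho>) x i)"
    proof
      fix s assume s: "s \<in> sphere_set n"
      have "max_coord n (\<lambda>i. - s i) = max_coord n s" by (simp add: max_coord_def)
      then have "\<rho> (\<lambda>i. - s i) = (\<lambda>i. - \<rho> s i)" by (simp add: \<rho>_def)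
      then show "(\<phi> \<circ> \<rho>) (\<lambda>i. - s i) = (\<lambda>i. - (\<phi> \<circ> \<rho>) s i)"
        using bspec[OF odd \<rho>[OF s]] by simp
    qed
    show "(\<phi> \<circ> \<rho>) s i = 0" if "s \<in> sphere_set n" "i \<ge> n" for s i
      using low[OF \<rho>] that by simp
  qed
  then show ?thesis using \<rho> by auto
qed

theorem equivariant_carrier_zero:
  fixes b :: "nat \<Rightarrow> 'a::euclidean_space" and Y :: "(nat \<Rightarrow> int) \<Rightarrow> 'y::topological_space set"
    and \<Lambda> :: "'y \<Rightarrow> nat \<Rightarrow> real"
  assumes b: "orthonormal_frame b n" and pos: "N > 0" "n > 0"
    and mono: "\<And>q x. q \<in> cube_cells n N \<Longrightarrow> x \<in> cell q \<Longrightarrow> Y (carrier_cell x) \<subseteq> Y q"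
    and conn: "\<And>q. q \<in> cube_cells n N \<Longrightarrow> n_connected_space (n - 1) (top_of_set (Y q))"
    and \<nu>: "continuous_on UNIV \<nu>" "\<And>y. \<nu> (\<nu> y) = y"
      "\<And>q. q \<in> cube_cells n N \<Longrightarrow> \<nu> ` Y q \<subseteq> Y (\<lambda>i. - q i)"
    and \<Lambda>: "continuous_on UNIV \<Lambda>" "\<And>y. \<Lambda> (\<nu> y) = (\<lambda>i. - \<Lambda> y i)" "\<And>y i. i \<ge> n \<Longrightarrow> \<Lambda> y i = 0"
  shows "\<exists>q\<in>cube_cells n N. \<exists>y\<in>Y q. \<Lambda> y = (\<lambda>_. 0)"
proof -
  obtain g where g: "continuous_on (cube_boundary n N) g"
    "\<forall>x\<in>cube_boundary n N. g (\<lambda>i. - x i) = \<nu> (g x)"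
    "\<forall>x\<in>cube_boundary n N. g x \<in> Y (carrier_cell x)"
  proof (rule equivariant_map_carried_by_cells[OF pos mono conn \<nu>])
  qed blast+
  have "\<exists>x\<in>cube_boundary n N. (\<Lambda> \<circ> g) x = (\<lambda>_. 0)"
  proof (rule Borsuk_Ulam_cube[OF b pos(1)])
    show "continuous_on (cube_boundary n N) (\<Lambda> \<circ> g)"
      by (intro continuous_on_compose g(1) continuous_on_subset[OF \<Lambda>(1)]) simp
  qed (use g(2) \<Lambda> in auto)
  then obtain x where x: "x \<in> cube_boundary n N" "\<Lambda> (g x) = (\<lambda>_. 0)" by auto
  then show ?thesis using g(3) carrier_cell_cube by blast
qed

section \<open>Fiber complexes and balanced labels\<close>

definition realization_points :: "'v set set \<Rightarrow> ('v \<Rightarrow> real) set" where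
  "realization_points K = {t. (\<forall>v. 0 \<le> t v) \<and> {v. t v \<noteq> 0} \<in> K \<and> (\<Sum>v | t v \<noteq> 0. t v) = 1}"

lemma geometric_realization_eq: "geometric_realization K = top_of_set (realization_points K)"
  by (simp add: geometric_realization_def realization_points_def euclidean_product_topology)

text \<open>The signed index \<open>+j\<close> is coded by the label \<open>2 * j\<close> and \<open>-j\<close> by \<open>2 * j + 1\<close>, so that the fibers consist of
natural numbers; flipping a label changes the sign and keeps \<open>j\<close>.\<close>

definition flip :: "nat \<Rightarrow> nat" where
  "flip y = (if even y then y + 1 else y - 1)"

lemma flip_flip [simp]: "flip (flip y) = y"
  by (auto simp: flip_def)

lemma even_flip [simp]: "even (flip y) \<longleftrightarrow> odd y"
  by (auto simp: flip_def)

lemma flip_div_2 [simp]: "flip y div 2 = y div 2"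
  by (auto simp: flip_def elim!: oddE)

definition flip_point :: "('w \<times> nat \<Rightarrow> real) \<Rightarrow> 'w \<times> nat \<Rightarrow> real" where
  "flip_point t = (\<lambda>(w, y). t (w, flip y))"

lemma flip_point_flip_point [simp]: "flip_point (flip_point t) = t"
  by (auto simp: flip_point_def)

lemma continuous_flip_point: "continuous_on S flip_point"
  by (intro continuous_on_coordinatewise_then_product)
    (auto simp: flip_point_def split_beta intro!: continuous_on_coordinate)

lemma flip_point_realization:
  assumes t: "t \<in> realization_points (fiber_complex K U (\<lambda>_. D))" and "U \<subseteq> U'" "flip ` D \<subseteq> D'"
  shows "flip_point t \<in> realization_points (fiber_complex K U' (\<lambda>_. D'))"
proof -
  define \<alpha> :: "'a \<times> nat \<Rightarrow> 'a \<times> nat" where "\<alpha> = (\<lambda>(w, y). (w, flip y))"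
  have \<alpha>\<alpha>: "\<alpha> (\<alpha> v) = v" for v by (simp add: \<alpha>_def split_beta)
  have fp: "flip_point t v = t (\<alpha> v)" for v by (simp add: \<alpha>_def flip_point_def split_beta)
  have supp: "{v. flip_point t v \<noteq> 0} = \<alpha> ` {v. t v \<noteq> 0}"
  proof (intro equalityI subsetI)
    fix v assume "v \<in> {v. flip_point t v \<noteq> 0}"
    then have "\<alpha> v \<in> {v. t v \<noteq> 0}" by (simp add: fp)
    then show "v \<in> \<alpha> ` {v. t v \<noteq> 0}" using \<alpha>\<alpha>[of v] by (metis imageI)
  qed (auto simp: fp \<alpha>\<alpha>)
  obtain \<sigma> y where \<sigma>: "{v. t v \<noteq> 0} = (\<lambda>w. (w, y w)) ` \<sigma>" "\<sigma> \<in> induced_subcomplex K U"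
    "\<forall>w\<in>\<sigma>. y w \<in> D"
    using t by (auto simp: realization_points_def fiber_complex_def)
  have "{v. flip_point t v \<noteq> 0} = (\<lambda>w. (w, flip (y w))) ` \<sigma>"
    unfolding supp \<sigma>(1) by (auto simp: \<alpha>_def image_image)
  moreover have "\<sigma> \<in> induced_subcomplex K U'" using \<sigma>(2) \<open>U \<subseteq> U'\<close> by (auto simp: induced_subcomplex_def)
  moreover have "\<forall>w\<in>\<sigma>. flip (y w) \<in> D'" using \<sigma>(3) \<open>flip ` D \<subseteq> D'\<close> by auto
  ultimately have "{v. flip_point t v \<noteq> 0} \<in> fiber_complex K U' (\<lambda>_. D')"
    unfolding fiber_complex_def by (intro CollectI exI[of _ \<sigma>] exI[of _ "\<lambda>w. flip (y w)"]) simp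
  moreover have "(\<Sum>v | flip_point t v \<noteq> 0. flip_point t v) = (\<Sum>v | t v \<noteq> 0. t v)"
    by (rule sum.reindex_bij_witness[of _ \<alpha> \<alpha>]) (auto simp: fp \<alpha>\<alpha>)
  moreover have "0 \<le> flip_point t v" "(\<Sum>v | t v \<noteq> 0. t v) = 1" for v
    using t by (simp_all add: realization_points_def fp del: split_paired_All)
  ultimately show ?thesis unfolding realization_points_def by (intro CollectI conjI allI) simp_all
qed

lemma fiber_complex_mono:
  assumes "U \<subseteq> U'" "D \<subseteq> D'"
  shows "realization_points (fiber_complex K U (\<lambda>_. D)) \<subseteq> realization_points (fiber_complex K U' (\<lambda>_. D'))"
proof -
  have "fiber_complex K U (\<lambda>_. D) \<subseteq> fiber_complex K U' (\<lambda>_. D')"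
    using assms unfolding fiber_complex_def induced_subcomplex_def by blast
  then show ?thesis by (auto simp: realization_points_def)
qed

lemma face_in_facet:
  assumes "finite K" "\<sigma> \<in> K"
  obtains B where "is_facet K B" "\<sigma> \<subseteq> B"
proof -
  obtain B where "B \<in> K" "\<sigma> \<subseteq> B" and max: "\<forall>\<tau>\<in>K. B \<subseteq> \<tau> \<longrightarrow> B = \<tau>"
    using finite_has_maximal2[OF assms] by blast
  then have "is_facet K B" unfolding is_facet_def by blast
  then show thesis using \<open>\<sigma> \<subseteq> B\<close> by (rule that)
qed

lemma admissible_selection_structureD:
  assumes "admissible_selection_structure d W K L"
  shows "0 < d" "K \<subseteq> Pow W" "L \<noteq> {}"
    and "U \<in> L \<Longrightarrow> U \<subseteq> U' \<Longrightarrow> U' \<subseteq> W \<Longrightarrow> U' \<in> L"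
    and "U \<in> L \<Longrightarrow> U \<subseteq> W"
    and "U \<in> L \<Longrightarrow> is_facet (induced_subcomplex K U) B \<Longrightarrow> is_facet K B"
proof -
  show "0 < d" using assms unfolding admissible_selection_structure_def by (elim conjE)
  show "K \<subseteq> Pow W" using assms unfolding admissible_selection_structure_def complex_on_def by (elim conjE)
  show "L \<noteq> {}" using assms unfolding admissible_selection_structure_def by (elim conjE)
  have "L \<subseteq> Pow W" using assms unfolding admissible_selection_structure_def by (elim conjE)
  then show "U \<in> L \<Longrightarrow> U \<subseteq> W" by blast
  have "\<forall>U\<in>L. \<forall>U'. U \<subseteq> U' \<and> U' \<subseteq> W \<longrightarrow> U' \<in> L"
    using assms unfolding admissible_selection_structure_def by (elim conjE)
  then show "U \<in> L \<Longrightarrow> U \<subseteq> U' \<Longrightarrow> U' \<subseteq> W \<Longrightarrow> U' \<in> L" by blast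
  have "\<forall>U\<in>L. \<forall>B. is_facet (induced_subcomplex K U) B \<longrightarrow> is_facet K B"
    using assms unfolding admissible_selection_structure_def by (elim conjE)
  then show "U \<in> L \<Longrightarrow> is_facet (induced_subcomplex K U) B \<Longrightarrow> is_facet K B" by blast
qed

lemma admissible_selection_structure_connected:
  fixes K :: "'w set set" and D :: "'w \<Rightarrow> nat set"
  assumes "admissible_selection_structure d W K L" "U \<in> L"
    and "\<forall>w\<in>W. finite (D w) \<and> D w \<noteq> {}"
  shows "n_connected_space (d - 1) (geometric_realization (fiber_complex K U D))"
proof -
  have "\<forall>D :: 'w \<Rightarrow> nat set. (\<forall>w\<in>W. finite (D w) \<and> D w \<noteq> {}) \<longrightarrow>
      (\<forall>U\<in>L. n_connected_space (d - 1) (geometric_realization (fiber_complex K U D)))"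
    using assms(1) unfolding admissible_selection_structure_def by (elim conjE)
  from this[rule_format, of D U] show ?thesis using assms(2,3) by blast
qed

text \<open>The linear extension \<open>\<Lambda>\<close> of the vectors \<open>p w y\<close> to the realization changes sign when all labels are flipped, so it vanishes at a
point of the fiber complex of some cell \<open>q\<close>. The barycentric coordinates of that point are the weights. Its support
projects to a face of \<open>K[U q]\<close>; this face is enlarged to a facet, where the additional vertices get weight \<open>0\<close>
and an arbitrary label of \<open>D q\<close>.\<close>

theorem facet_of_balanced_labels:
  fixes b :: "nat \<Rightarrow> 'a::euclidean_space" and p :: "'w \<Rightarrow> nat \<Rightarrow> nat \<Rightarrow> real"
  assumes b: "orthonormal_frame b d" and "N > 0" and W: "finite W"
    and adm: "admissible_selection_structure d W K L"
    and C: "finite C" "flip ` C \<subseteq> C"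
    and U: "\<And>q. q \<in> cube_cells d N \<Longrightarrow> U q \<in> L"
      "\<And>q x. q \<in> cube_cells d N \<Longrightarrow> x \<in> cell q \<Longrightarrow> U (carrier_cell x) \<subseteq> U q"
      "\<And>q. q \<in> cube_cells d N \<Longrightarrow> U q \<subseteq> U (\<lambda>i. - q i)"
    and D: "\<And>q. q \<in> cube_cells d N \<Longrightarrow> D q \<noteq> {} \<and> D q \<subseteq> C"
      "\<And>q x. q \<in> cube_cells d N \<Longrightarrow> x \<in> cell q \<Longrightarrow> D (carrier_cell x) \<subseteq> D q"
      "\<And>q. q \<in> cube_cells d N \<Longrightarrow> flip ` D q \<subseteq> D (\<lambda>i. - q i)"
    and p: "\<And>w y i. p w (flip y) i = - p w y i"
      "\<And>w y i. i \<ge> d \<Longrightarrow> p w y i = 0"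
  shows "\<exists>q B y c. q \<in> cube_cells d N \<and> is_facet K B \<and>
    (\<forall>w\<in>B. w \<in> U q \<and> y w \<in> D q \<and> (0::real) \<le> c w) \<and>
    (\<Sum>w\<in>B. c w) = 1 \<and> (\<forall>i. (\<Sum>w\<in>B. c w * p w (y w) i) = 0)"
proof -
  define Y where "Y q = realization_points (fiber_complex K (U q) (\<lambda>_. D q))" for q
  define \<Lambda> where "\<Lambda> t i = (\<Sum>v\<in>W \<times> C. t v * p (fst v) (snd v) i)" for t i
  note d = admissible_selection_structureD(1)[OF adm] and KW = admissible_selection_structureD(2)[OF adm]
  have flip_C: "flip y \<in> C \<longleftrightarrow> y \<in> C" for y
  proof -
    have "z \<in> C \<Longrightarrow> flip z \<in> C" for z using C(2) by blast
    from this[of y] this[of "flip y"] show ?thesis by auto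
  qed
  have "\<exists>q\<in>cube_cells d N. \<exists>t\<in>Y q. \<Lambda> t = (\<lambda>_. 0)"
  proof (rule equivariant_carrier_zero[OF b \<open>N > 0\<close> d, of Y flip_point \<Lambda>])
    show "Y (carrier_cell x) \<subseteq> Y q" if "q \<in> cube_cells d N" "x \<in> cell q" for q x
      unfolding Y_def using that by (intro fiber_complex_mono U D)
    show "n_connected_space (d - 1) (top_of_set (Y q))" if "q \<in> cube_cells d N" for q
    proof -
      have "finite (D q)" using D(1)[OF that] C(1) finite_subset by blast
      then have "n_connected_space (d - 1) (geometric_realization (fiber_complex K (U q) (\<lambda>_. D q)))"
        using D(1)[OF that] by (intro admissible_selection_structure_connected[OF adm U(1)[OF that]]) simp
      then show ?thesis by (simp add: geometric_realization_eq Y_def)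
    qed
    show "flip_point ` Y q \<subseteq> Y (\<lambda>i. - q i)" if "q \<in> cube_cells d N" for q
      unfolding Y_def by (intro image_subsetI flip_point_realization[OF _ U(3)[OF that] D(3)[OF that]])
    show "continuous_on UNIV \<Lambda>"
      unfolding \<Lambda>_def by (intro continuous_on_coordinatewise_then_product continuous_intros)
    show "\<Lambda> (flip_point t) = (\<lambda>i. - \<Lambda> t i)" for t
    proof
      fix i
      have "\<Lambda> (flip_point t) i = (\<Sum>v\<in>W \<times> C. t v * p (fst v) (flip (snd v)) i)"
        unfolding \<Lambda>_def
        by (rule sum.reindex_bij_witness[of _ "\<lambda>(w, y). (w, flip y)" "\<lambda>(w, y). (w, flip y)"])
          (auto simp: flip_point_def flip_C)
      then show "\<Lambda> (flip_point t) i = - \<Lambda> t i" by (simp add: p(1) \<Lambda>_def sum_negf)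
    qed
    show "\<Lambda> t i = 0" if "i \<ge> d" for t i using p(2)[OF that] by (simp add: \<Lambda>_def)
    show "continuous_on UNIV (flip_point :: ('w \<times> nat \<Rightarrow> real) \<Rightarrow> _)" by (rule continuous_flip_point)
  qed simp
  then obtain q t where q: "q \<in> cube_cells d N" "t \<in> Y q" "\<Lambda> t = (\<lambda>_. 0)" by blast
  obtain \<sigma> y where \<sigma>: "{v. t v \<noteq> 0} = (\<lambda>w. (w, y w)) ` \<sigma>" "\<sigma> \<in> induced_subcomplex K (U q)"
    "\<forall>w\<in>\<sigma>. y w \<in> D q"
  proof -
    have "{v. t v \<noteq> 0} \<in> fiber_complex K (U q) (\<lambda>_. D q)"
      using q(2) by (simp add: Y_def realization_points_def del: split_paired_All)
    then show thesis using that unfolding fiber_complex_def by blast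
  qed
  have t: "\<And>v. 0 \<le> t v" "(\<Sum>v | t v \<noteq> 0. t v) = 1"
    using q(2) by (simp_all add: Y_def realization_points_def del: split_paired_All)
  have "finite K" using KW W by (meson finite_Pow_iff finite_subset)
  then have "finite (induced_subcomplex K (U q))" by (simp add: induced_subcomplex_def)
  then obtain B where B: "is_facet (induced_subcomplex K (U q)) B" "\<sigma> \<subseteq> B"
    using \<sigma>(2) by (rule face_in_facet)
  then have facet: "is_facet K B"
    by (intro admissible_selection_structureD(6)[OF adm U(1)[OF q(1)]])
  have BU: "B \<subseteq> U q" "B \<in> K" using B(1) by (auto simp: is_facet_def induced_subcomplex_def)
  then have "B \<subseteq> W" using KW by blast
  then have BW: "B \<subseteq> W" "finite B" using finite_subset[OF _ W] by blast+
  obtain y0 where y0: "y0 \<in> D q" using D(1)[OF q(1)] by blast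
  define y' where "y' w = (if w \<in> \<sigma> then y w else y0)" for w
  define c where "c w = (if w \<in> \<sigma> then t (w, y w) else 0)" for w
  have inj: "inj_on (\<lambda>w. (w, y w)) \<sigma>" by (auto simp: inj_on_def)
  show ?thesis
  proof (intro exI conjI)
    show "\<forall>w\<in>B. w \<in> U q \<and> y' w \<in> D q \<and> 0 \<le> c w"
      using BU(1) \<sigma>(3) y0 t(1) by (auto simp: y'_def c_def)
    have "1 = (\<Sum>w\<in>\<sigma>. t (w, y w))" using t(2) unfolding \<sigma>(1) by (simp add: sum.reindex[OF inj])
    also have "\<dots> = (\<Sum>w\<in>B. c w)"
      using B(2) BW(2) by (intro sum.mono_neutral_cong_left) (auto simp: c_def)
    finally show "(\<Sum>w\<in>B. c w) = 1" by simp
    show "\<forall>i. (\<Sum>w\<in>B. c w * p w (y' w) i) = 0"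
    proof
      fix i
      have sub: "{v. t v \<noteq> 0} \<subseteq> W \<times> C"
        unfolding \<sigma>(1) using B(2) BW(1) \<sigma>(3) D(1)[OF q(1)] by auto
      have "0 = \<Lambda> t i" using q(3) by simp
      also have "\<dots> = (\<Sum>v | t v \<noteq> 0. t v * p (fst v) (snd v) i)"
        unfolding \<Lambda>_def using sub W C(1) by (intro sum.mono_neutral_right) auto
      also have "\<dots> = (\<Sum>w\<in>\<sigma>. t (w, y w) * p w (y w) i)"
        unfolding \<sigma>(1) by (simp add: sum.reindex[OF inj])
      also have "\<dots> = (\<Sum>w\<in>B. c w * p w (y' w) i)"
        using B(2) BW(2) by (intro sum.mono_neutral_cong_left) (auto simp: c_def y'_def)
      finally show "(\<Sum>w\<in>B. c w * p w (y' w) i) = 0" by simp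
    qed
    show "q \<in> cube_cells d N" "is_facet K B" by (fact q(1), fact facet)
  qed
qed

section \<open>Measures of half-spaces\<close>

definition excess :: "'a::euclidean_space measure \<Rightarrow> 'a \<times> real \<Rightarrow> real" where
  "excess M p = measure M {x. snd p \<le> fst p \<bullet> x} - 1/2"

lemma halfspace_borel: "{x::'a::euclidean_space. b \<le> a \<bullet> x} \<in> sets borel"
  by (intro borel_closed closed_halfspace_ge)

text \<open>Parameters with \<open>fst p = 0\<close> are included: then \<open>snd p \<noteq> 0\<close> and the set is empty.\<close>

lemma hyperplane_null:
  fixes M :: "'a::euclidean_space measure"
  assumes "absolutely_continuous lborel M" and "p \<noteq> 0"
  shows "{x. fst p \<bullet> x = snd p} \<in> null_sets M"
proof -
  have "fst p \<noteq> 0 \<or> snd p \<noteq> 0" using assms(2) by (auto simp: prod_eq_iff)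
  then have "negligible {x. fst p \<bullet> x = snd p}" by (rule negligible_hyperplane)
  then have "{x. fst p \<bullet> x = snd p} \<in> null_sets lebesgue" by (simp add: negligible_iff_null_sets)
  moreover have "{x. fst p \<bullet> x = snd p} \<in> sets borel" by (intro borel_closed closed_hyperplane)
  ultimately have "{x. fst p \<bullet> x = snd p} \<in> null_sets lborel" by (simp add: null_sets_completion_iff)
  then show ?thesis using assms(1) by (auto simp: absolutely_continuous_def)
qed

lemma excess_minus:
  fixes M :: "'a::euclidean_space measure"
  assumes M: "prob_space M" "sets M = sets borel" and ac: "absolutely_continuous lborel M" and p: "p \<noteq> 0"
  shows "excess M (- p) = - excess M p"
proof -
  interpret prob_space M by (rule M)
  have sp: "space M = UNIV" using sets_eq_imp_space_eq[OF M(2)] by simp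
  let ?A = "{x. snd p \<le> fst p \<bullet> x}" and ?H = "{x. fst p \<bullet> x = snd p}"
  have A: "?A \<in> sets M" using M(2) halfspace_borel by simp
  have H: "?H \<in> null_sets M" by (rule hyperplane_null[OF ac p])
  have "{x. snd (- p) \<le> fst (- p) \<bullet> x} = (space M - ?A) \<union> ?H" by (auto simp: sp)
  then have "measure M {x. snd (- p) \<le> fst (- p) \<bullet> x} = measure M (space M - ?A)"
    using H A by (simp add: measure_Un_null_set)
  also have "\<dots> = 1 - measure M ?A" by (rule prob_compl[OF A])
  finally show ?thesis by (simp add: excess_def)
qed

lemma excess_vertical:
  fixes M :: "'a::euclidean_space measure"
  assumes M: "prob_space M" "sets M = sets borel" and "fst p = 0" "p \<noteq> 0"
  shows "excess M p = (if snd p < 0 then 1/2 else - 1/2)"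
proof -
  interpret prob_space M by (rule M)
  have sp: "space M = UNIV" using sets_eq_imp_space_eq[OF M(2)] by simp
  have "snd p \<noteq> 0" using assms(3,4) by (auto simp: prod_eq_iff)
  then show ?thesis
    using prob_space assms(3) by (auto simp: excess_def sp)
qed

text \<open>The indicator functions of the half-spaces converge pointwise off the limiting hyperplane, which is a null set, so dominated
convergence applies.\<close>

lemma continuous_excess:
  fixes M :: "'a::euclidean_space measure"
  assumes M: "prob_space M" "sets M = sets borel" and ac: "absolutely_continuous lborel M"
  shows "continuous_on (- {0}) (excess M)"
  unfolding continuous_on_sequentially
proof (intro allI ballI impI, elim conjE)
  interpret prob_space M by (rule M)
  fix P :: "nat \<Rightarrow> 'a \<times> real" and p
  assume p: "p \<in> - {0}" and lim: "P \<longlonglongrightarrow> p"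
  let ?A = "\<lambda>p. {x. snd p \<le> fst p \<bullet> x}"
  have A: "?A p \<in> sets M" for p using M(2) halfspace_borel by simp
  have "(\<lambda>k. integral\<^sup>L M (indicat_real (?A (P k)))) \<longlonglongrightarrow> integral\<^sup>L M (indicat_real (?A p))"
  proof (rule integral_dominated_convergence[where w = "\<lambda>_. 1"])
    have "AE x in M. x \<notin> {x. fst p \<bullet> x = snd p}"
      using hyperplane_null[OF ac] p by (intro AE_not_in) auto
    then show "AE x in M. (\<lambda>k. indicat_real (?A (P k)) x) \<longlonglongrightarrow> indicat_real (?A p) x"
    proof eventually_elim
      case (elim x)
      have l: "(\<lambda>k. fst (P k) \<bullet> x - snd (P k)) \<longlonglongrightarrow> fst p \<bullet> x - snd p"
        by (intro tendsto_intros lim)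
      have "\<forall>\<^sub>F k in sequentially. indicat_real (?A (P k)) x = indicat_real (?A p) x"
      proof (cases "snd p < fst p \<bullet> x")
        case True
        then have "\<forall>\<^sub>F k in sequentially. 0 < fst (P k) \<bullet> x - snd (P k)"
          by (intro order_tendstoD(1)[OF l]) simp
        then show ?thesis by eventually_elim (use True in \<open>simp add: indicator_def\<close>)
      next
        case False
        then have "fst p \<bullet> x < snd p" using elim by simp
        then have "\<forall>\<^sub>F k in sequentially. fst (P k) \<bullet> x - snd (P k) < 0"
          by (intro order_tendstoD(2)[OF l]) simp
        then show ?thesis by eventually_elim (use \<open>fst p \<bullet> x < snd p\<close> in \<open>simp add: indicator_def\<close>)
      qed
      then show ?case by (rule tendsto_eventually)
    qed
  qed (use A in auto)
  then have "(\<lambda>k. measure M (?A (P k))) \<longlonglongrightarrow> measure M (?A p)" by (simp add: A)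
  then show "(excess M \<circ> P) \<longlonglongrightarrow> excess M p"
    unfolding comp_def excess_def by (intro tendsto_intros)
qed

section \<open>Passing to the limit\<close>

text \<open>One index \<open>\<pi>\<close> serves infinitely many \<open>N\<close>, and the corresponding points \<open>p\<close> have a convergent subsequence. Its limit is also the
limit of points of each of the closed sets.\<close>

lemma common_point_of_nearly_meeting_closed_sets:
  fixes X :: "'a::metric_space set" and \<S> :: "'p \<Rightarrow> 'a set set"
  assumes "compact X" "finite P" and cl: "\<forall>\<pi>\<in>P. \<forall>s\<in>\<S> \<pi>. closed s"
    and near: "\<forall>N>0. \<exists>\<pi>\<in>P. \<exists>p\<in>X. \<forall>s\<in>\<S> \<pi>. \<exists>u\<in>s. dist u p \<le> c / real N"
  shows "\<exists>\<pi>\<in>P. \<exists>p\<in>X. \<forall>s\<in>\<S> \<pi>. p \<in> s"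
proof -
  define good where "good N z \<longleftrightarrow> fst z \<in> P \<and> snd z \<in> X \<and>
    (\<forall>s\<in>\<S> (fst z). \<exists>u\<in>s. dist u (snd z) \<le> c / real (Suc N))" for N z
  have "\<exists>z. good N z" for N
  proof -
    obtain \<pi> p where "\<pi> \<in> P" "p \<in> X" "\<forall>s\<in>\<S> \<pi>. \<exists>u\<in>s. dist u p \<le> c / real (Suc N)"
      using near[rule_format, of "Suc N"] by blast
    then have "good N (\<pi>, p)" by (simp add: good_def)
    then show ?thesis ..
  qed
  then obtain z where z: "\<And>N. good N (z N)" by metis
  define \<pi> p where "\<pi> N = fst (z N)" and "p N = snd (z N)" for N
  have \<pi>: "\<And>N. \<pi> N \<in> P" and p: "\<And>N. p N \<in> X"
    and u: "\<And>N. \<forall>s\<in>\<S> (\<pi> N). \<exists>u\<in>s. dist u (p N) \<le> c / real (Suc N)"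
    using z unfolding good_def \<pi>_def p_def by blast+
  have "\<exists>\<pi>0\<in>P. infinite {N. \<pi> N = \<pi>0}"
  proof (rule ccontr)
    assume "\<not> ?thesis"
    then have "finite (\<Union>\<pi>0\<in>P. {N. \<pi> N = \<pi>0})" using \<open>finite P\<close> by simp
    moreover have "(\<Union>\<pi>0\<in>P. {N. \<pi> N = \<pi>0}) = UNIV" using \<pi> by auto
    ultimately show False by simp
  qed
  then obtain \<pi>0 where \<pi>0: "\<pi>0 \<in> P" "infinite {N. \<pi> N = \<pi>0}" by blast
  define r where "r = enumerate {N. \<pi> N = \<pi>0}"
  have r: "strict_mono r" unfolding r_def by (rule strict_mono_enumerate[OF \<pi>0(2)])
  have \<pi>r: "\<pi> (r k) = \<pi>0" for k using enumerate_in_set[OF \<pi>0(2)] by (simp add: r_def)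
  have "seq_compact X" using \<open>compact X\<close> by (simp add: compact_eq_seq_compact_metric)
  moreover have "\<forall>k. (p \<circ> r) k \<in> X" using p by simp
  ultimately obtain l r' where l: "l \<in> X" "strict_mono r'" "((p \<circ> r) \<circ> r') \<longlonglongrightarrow> l"
    by (rule seq_compactE)
  have "l \<in> s" if s: "s \<in> \<S> \<pi>0" for s
  proof -
    have "\<forall>k. \<exists>v\<in>s. dist v (p (r (r' k))) \<le> c / real (Suc (r (r' k)))"
    proof
      fix k
      have "s \<in> \<S> (\<pi> (r (r' k)))" using s \<pi>r by simp
      then show "\<exists>v\<in>s. dist v (p (r (r' k))) \<le> c / real (Suc (r (r' k)))" by (rule bspec[OF u])
    qed
    then have "\<exists>v. \<forall>k. v k \<in> s \<and> dist (v k) (p (r (r' k))) \<le> c / real (Suc (r (r' k)))"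
      unfolding Bex_def by (rule choice)
    then obtain v where v: "\<And>k. v k \<in> s" "\<And>k. dist (v k) (p (r (r' k))) \<le> c / real (Suc (r (r' k)))"
      by blast
    have "strict_mono (r \<circ> r')" using r l(2) by (rule strict_mono_o)
    have "(\<lambda>N. c / real (Suc N)) \<longlonglongrightarrow> 0" by (rule LIMSEQ_Suc) (rule lim_const_over_n)
    from LIMSEQ_subseq_LIMSEQ[OF this \<open>strict_mono (r \<circ> r')\<close>]
    have bound: "(\<lambda>k. c / real (Suc (r (r' k)))) \<longlonglongrightarrow> 0" unfolding comp_def .
    have d0: "(\<lambda>k. dist (v k) (p (r (r' k)))) \<longlonglongrightarrow> 0"
      by (rule Lim_null_comparison[OF always_eventually bound])
        (simp only: real_norm_def abs_of_nonneg zero_le_dist v(2) simp_thms)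
    have "(\<lambda>k. dist (p (r (r' k))) l) \<longlonglongrightarrow> 0"
      using iffD1[OF tendsto_dist_iff l(3)] unfolding comp_def .
    from tendsto_add[OF d0 this]
    have sum0: "(\<lambda>k. dist (v k) (p (r (r' k))) + dist (p (r (r' k))) l) \<longlonglongrightarrow> 0" by simp
    have "(\<lambda>k. dist (v k) l) \<longlonglongrightarrow> 0"
      by (rule Lim_null_comparison[OF always_eventually sum0]) (simp add: dist_triangle)
    then have "v \<longlonglongrightarrow> l" by (rule iffD2[OF tendsto_dist_iff])
    then show "l \<in> s" by (rule closed_sequentially[OF bspec[OF bspec[OF cl \<pi>0(1)] s] v(1)])
  qed
  then show ?thesis using \<pi>0(1) l(1) by blast
qed

text \<open>The condition on the signs gives each sign class total weight \<open>1/2\<close>, so doubled weights are convex coefficients; the vector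
condition says that the two convex combinations coincide.\<close>

lemma balanced_signs_hulls_meet:
  fixes v :: "'w \<Rightarrow> 'b::real_vector" and c \<epsilon> :: "'w \<Rightarrow> real"
  assumes "finite B" "\<forall>w\<in>B. 0 \<le> c w" "(\<Sum>w\<in>B. c w) = 1" and \<epsilon>: "\<forall>w\<in>B. \<epsilon> w = 1 \<or> \<epsilon> w = - 1"
    and bal: "(\<Sum>w\<in>B. c w * \<epsilon> w) = 0" "(\<Sum>w\<in>B. (c w * \<epsilon> w) *\<^sub>R v w) = 0"
  shows "convex hull (v ` {w\<in>B. \<epsilon> w = 1}) \<inter> convex hull (v ` {w\<in>B. \<epsilon> w = -1}) \<noteq> {}"
proof -
  let ?P = "{w\<in>B. \<epsilon> w = 1}" and ?M = "{w\<in>B. \<epsilon> w = - 1}"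
  have "finite ?P" "finite ?M" using \<open>finite B\<close> by simp_all
  moreover have "?P \<inter> ?M = {}" by force
  ultimately have split: "sum g (?P \<union> ?M) = sum g ?P + sum g ?M"
    and split_v: "sum h (?P \<union> ?M) = sum h ?P + sum h ?M" for g :: "'w \<Rightarrow> real" and h :: "'w \<Rightarrow> 'b"
    by (simp_all only: sum.union_disjoint)
  have B: "?P \<union> ?M = B" using \<epsilon> by blast
  note split = split[unfolded B] and split_v = split_v[unfolded B]
  have "(\<Sum>w\<in>?P. c w * \<epsilon> w) = sum c ?P" "(\<Sum>w\<in>?M. c w * \<epsilon> w) = (\<Sum>w\<in>?M. - c w)"
    by (auto intro!: sum.cong)
  then have s: "sum c ?P = 1/2" "sum c ?M = 1/2"
    using bal(1) assms(3) split[of c] split[of "\<lambda>w. c w * \<epsilon> w"] unfolding sum_negf by linarith+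
  have "(\<Sum>w\<in>?P. (c w * \<epsilon> w) *\<^sub>R v w) = (\<Sum>w\<in>?P. c w *\<^sub>R v w)"
    "(\<Sum>w\<in>?M. (c w * \<epsilon> w) *\<^sub>R v w) = (\<Sum>w\<in>?M. - (c w *\<^sub>R v w))"
    by (auto intro!: sum.cong)
  then have "(\<Sum>w\<in>?P. c w *\<^sub>R v w) + - (\<Sum>w\<in>?M. c w *\<^sub>R v w) = 0"
    using bal(2) unfolding split_v[of "\<lambda>w. (c w * \<epsilon> w) *\<^sub>R v w"] sum_negf by (simp only:)
  then have eq: "(\<Sum>w\<in>?P. c w *\<^sub>R v w) = (\<Sum>w\<in>?M. c w *\<^sub>R v w)"
    unfolding add_uminus_conv_diff by (rule eq_iff_diff_eq_0[THEN iffD2])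
  have hull: "2 *\<^sub>R (\<Sum>w\<in>S. c w *\<^sub>R v w) \<in> convex hull (v ` S)" if "S \<subseteq> B" "sum c S = 1/2" for S
  proof -
    have "(\<Sum>w\<in>S. (2 * c w) *\<^sub>R v w) \<in> convex hull (v ` S)"
    proof (rule convex_sum)
      show "finite S" using that(1) \<open>finite B\<close> by (rule finite_subset)
      have "(\<Sum>w\<in>S. 2 * c w) = 2 * sum c S" by (rule sum_distrib_left[symmetric])
      then show "(\<Sum>w\<in>S. 2 * c w) = 1" unfolding that(2) by simp
      show "0 \<le> 2 * c w" if "w \<in> S" for w using assms(2) \<open>S \<subseteq> B\<close> that by auto
      show "v w \<in> convex hull v ` S" if "w \<in> S" for w using that by (intro hull_inc imageI)
    qed (rule convex_convex_hull)
    then show ?thesis by (simp only: scaleR_sum_right scaleR_scaleR)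
  qed
  have "2 *\<^sub>R (\<Sum>w\<in>?P. c w *\<^sub>R v w) \<in> convex hull (v ` ?P)"
    using s(1) by (intro hull) blast+
  moreover have "2 *\<^sub>R (\<Sum>w\<in>?P. c w *\<^sub>R v w) \<in> convex hull (v ` ?M)"
    unfolding eq using s(2) by (intro hull) blast+
  ultimately show ?thesis by blast
qed

section \<open>Dominant labels\<close>

definition label_sign :: "nat \<Rightarrow> real" where
  "label_sign y = (if even y then 1 else - 1)"

lemma label_sign_flip [simp]: "label_sign (flip y) = - label_sign y"
  by (simp add: label_sign_def)

definition signed_labels :: "nat \<Rightarrow> nat set" where
  "signed_labels m = {y. y div 2 \<in> {1..m}}"

lemma finite_signed_labels: "finite (signed_labels m)"
proof (rule finite_subset)
  show "signed_labels m \<subseteq> {..2 * m + 1}" by (auto simp: signed_labels_def)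
qed simp

text \<open>A label dominant at \<open>p\<close> records an index at which \<open>\<bar>F i p\<bar>\<close> is maximal together with the sign of the excess there.\<close>

definition dominant_region :: "(nat \<Rightarrow> 'e \<Rightarrow> real) \<Rightarrow> nat \<Rightarrow> nat \<Rightarrow> 'e set" where
  "dominant_region F m y = {p. \<forall>i\<in>{1..m}. \<bar>F i p\<bar> \<le> label_sign y * F (y div 2) p}"

lemma dominant_region_cover:
  assumes "0 < m"
  shows "\<exists>y\<in>signed_labels m. p \<in> dominant_region F m y"
proof -
  have "finite ((\<lambda>i. \<bar>F i p\<bar>) ` {1..m})" "(\<lambda>i. \<bar>F i p\<bar>) ` {1..m} \<noteq> {}" using assms by auto
  then have "Max ((\<lambda>i. \<bar>F i p\<bar>) ` {1..m}) \<in> (\<lambda>i. \<bar>F i p\<bar>) ` {1..m}" by (rule Max_in)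
  then obtain j where j: "j \<in> {1..m}" "\<bar>F j p\<bar> = Max ((\<lambda>i. \<bar>F i p\<bar>) ` {1..m})" by auto
  then have max: "\<forall>i\<in>{1..m}. \<bar>F i p\<bar> \<le> \<bar>F j p\<bar>" by simp
  define y where "y = (if F j p \<ge> 0 then 2 * j else 2 * j + 1)"
  have "y div 2 = j" "label_sign y * F j p = \<bar>F j p\<bar>" by (auto simp: y_def label_sign_def)
  then show ?thesis using j(1) max by (intro bexI[of _ y]) (auto simp: dominant_region_def signed_labels_def)
qed

text \<open>Equivalently, \<open>0\<close> is a convex combination of the vectors \<open>\<plusminus>(x w j, 1)\<close> that belong to the labels of \<open>B\<close>.\<close>

definition balanced_labels :: "('w \<Rightarrow> nat \<Rightarrow> 'b::real_vector) \<Rightarrow> 'w set \<Rightarrow> ('w \<Rightarrow> nat) \<Rightarrow> bool" where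
  "balanced_labels x B y \<longleftrightarrow> (\<exists>c. (\<forall>w\<in>B. 0 \<le> c w) \<and> (\<Sum>w\<in>B. c w) = 1 \<and>
     (\<Sum>w\<in>B. c w * label_sign (y w)) = 0 \<and>
     (\<Sum>w\<in>B. (c w * label_sign (y w)) *\<^sub>R x w (y w div 2)) = 0)"

lemma orthonormal_frame_exists:
  assumes "DIM('e) = Suc d"
  shows "\<exists>b :: nat \<Rightarrow> 'e::euclidean_space. orthonormal_frame b d"
proof -
  obtain b where b: "bij_betw b {0..<card (Basis :: 'e set)} (Basis :: 'e set)"
    using ex_bij_betw_nat_finite[of "Basis :: 'e set"] by auto
  have "orthonormal_frame b d"
    unfolding orthonormal_frame_def
  proof (intro allI impI)
    fix i j assume "i \<le> d" "j \<le> d"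
    then have ij: "i \<in> {0..<card (Basis :: 'e set)}" "j \<in> {0..<card (Basis :: 'e set)}"
      using assms by auto
    then have "b i \<in> Basis" "b j \<in> Basis" using b by (auto simp: bij_betw_def)
    moreover have "b i = b j \<longleftrightarrow> i = j" using b ij by (auto simp: bij_betw_def inj_on_def)
    ultimately show "b i \<bullet> b j = (if i = j then 1 else 0)" by (simp add: inner_Basis)
  qed
  then show ?thesis by (rule exI[of _ b])
qed

lemma subspace_coordinates:
  fixes V :: "'b::euclidean_space set"
  assumes V: "subspace V" and k: "dim V = k"
  shows "\<exists>e :: nat \<Rightarrow> 'b. \<forall>v\<in>V. (\<forall>i<k. v \<bullet> e i = 0) \<longrightarrow> v = 0"
proof -
  obtain B where B: "B \<subseteq> V" "independent B" "card B = dim V" "span B = V"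
    using orthonormal_basis_subspace[OF V] by metis
  obtain e where e: "bij_betw e {0..<card B} B"
    using ex_bij_betw_nat_finite[OF independent_imp_finite[OF B(2)]] by blast
  show ?thesis
  proof (intro exI ballI impI)
    fix v assume v: "v \<in> V" "\<forall>i<k. v \<bullet> e i = 0"
    have "v \<bullet> u = 0" if "u \<in> B" for u
    proof -
      have "u \<in> e ` {0..<card B}" using e that by (simp add: bij_betw_def)
      then obtain i where "i < card B" "u = e i" by auto
      then show ?thesis using v(2) B(3) k by simp
    qed
    then have "orthogonal v v"
      by (intro orthogonal_to_span[of v B v]) (use B(4) v(1) in \<open>auto simp: orthogonal_def\<close>)
    then show "v = 0" by (simp add: orthogonal_self)
  qed
qed

text \<open>The result of one subdivision of the cube. The linear map \<open>T\<close> scales the boundary of the cube with edge length \<open>4 * N\<close> to a fixed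
size inside the shell \<open>X\<close>, which keeps away from the origin; the image of a cell has diameter at most \<open>(d + 1) / N\<close>. The vectors
\<open>p w y\<close> are the coordinates of \<open>\<plusminus>(x w j, 1)\<close>: the first \<open>d - 1\<close> detect the elements of \<open>V\<close>,
and the last one is the sign.\<close>

lemma approximate_solution:
  fixes F :: "nat \<Rightarrow> 'e::euclidean_space \<Rightarrow> real" and A :: "'w \<Rightarrow> 'e set"
    and V :: "'b::euclidean_space set" and x :: "'w \<Rightarrow> nat \<Rightarrow> 'b"
  assumes dim: "DIM('e) = Suc d" and "0 < m" "0 < N" and W: "finite W"
    and adm: "admissible_selection_structure d W K L"
    and V: "subspace V" "dim V = d - 1"
    and x: "\<And>w i. w \<in> W \<Longrightarrow> i \<in> {1..m} \<Longrightarrow> x w i \<in> V"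
    and F: "\<And>i p. i \<in> {1..m} \<Longrightarrow> p \<noteq> 0 \<Longrightarrow> F i (- p) = - F i p"
    and A: "\<And>w p. p \<in> A w \<Longrightarrow> - p \<in> A w"
    and A_in_L: "\<And>p. p \<noteq> 0 \<Longrightarrow> {w \<in> W. p \<in> A w} \<in> L"
    and X_def: "X = {p. 1 \<le> norm p \<and> norm p \<le> real (d + 1)}"
  shows "\<exists>B y p. is_facet K B \<and> y \<in> B \<rightarrow> signed_labels m \<and> balanced_labels x B y \<and> p \<in> X \<and>
    (\<forall>w\<in>B. (\<exists>u\<in>X \<inter> A w. dist u p \<le> real (d + 1) / real N) \<and>
           (\<exists>u\<in>X \<inter> dominant_region F m (y w). dist u p \<le> real (d + 1) / real N))"
proof -
  have d: "0 < d" using admissible_selection_structureD(1)[OF adm] .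
  obtain b :: "nat \<Rightarrow> 'e" where b: "orthonormal_frame b d" using orthonormal_frame_exists[OF dim] by (elim exE)
  obtain e :: "nat \<Rightarrow> 'b" where e: "\<forall>v\<in>V. (\<forall>i<d - 1. v \<bullet> e i = 0) \<longrightarrow> v = 0"
    using subspace_coordinates[OF V] by (elim exE)
  define T where "T z = (1 / (2 * real N)) *\<^sub>R frame_combine b d z" for z
  have T_minus: "T (\<lambda>i. - z i) = - T z" for z by (simp add: T_def frame_combine_minus)
  have TX: "T z \<in> X" if z: "z \<in> cube_boundary d N" for z
  proof -
    let ?n = "norm (frame_combine b d z)"
    have sq: "?n\<^sup>2 = (\<Sum>i\<le>d. (z i)\<^sup>2)" by (rule norm_frame_combine[OF b])
    obtain j where j: "j \<le> d" "\<bar>z j\<bar> = 2 * real N" using z by (auto simp: cube_boundary_def)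
    have "(2 * real N)\<^sup>2 = (z j)\<^sup>2" using j(2) by (metis power2_abs)
    also have "\<dots> \<le> ?n\<^sup>2" unfolding sq using j(1) by (intro member_le_sum) auto
    finally have lo: "2 * real N \<le> ?n" by (rule power2_le_imp_le) simp
    have "?n \<le> (\<Sum>i\<le>d. norm (z i *\<^sub>R b i))" unfolding frame_combine_def by (rule norm_sum)
    also have "\<dots> \<le> (\<Sum>i\<le>d. 2 * real N)"
    proof (rule sum_mono)
      fix i assume i: "i \<in> {..d}"
      then have "b i \<bullet> b i = 1" using b by (simp add: orthonormal_frame_def)
      then have "norm (b i) = 1" by (simp add: norm_eq_1)
      then show "norm (z i *\<^sub>R b i) \<le> 2 * real N" using z i by (simp add: cube_boundary_def)
    qed
    finally have hi: "?n \<le> real (d + 1) * (2 * real N)" by simp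
    have "norm (T z) = ?n / (2 * real N)" by (simp add: T_def)
    moreover have "1 \<le> ?n / (2 * real N)" using lo \<open>0 < N\<close> by (simp add: le_divide_eq)
    moreover have "?n / (2 * real N) \<le> real (d + 1)" using hi \<open>0 < N\<close> by (simp only: divide_le_eq) simp
    ultimately show ?thesis by (simp add: X_def)
  qed
  have T0: "T z \<noteq> 0" if "z \<in> cube_boundary d N" for z using TX[OF that] by (auto simp: X_def)
  have T_close: "dist (T z) (T z') \<le> real (d + 1) / real N" if z: "z \<in> cell q" "z' \<in> cell q" for z z' q
  proof -
    have zz: "\<bar>z i - z' i\<bar> \<le> 2" for i
    proof -
      have "if odd (q i) then \<bar>z i - q i\<bar> \<le> 1 else z i = q i"
        "if odd (q i) then \<bar>z' i - q i\<bar> \<le> 1 else z' i = q i" using z by (simp_all add: cell_def)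
      then show ?thesis by (auto split: if_splits)
    qed
    have "T z - T z' = (1 / (2 * real N)) *\<^sub>R (\<Sum>i\<le>d. (z i - z' i) *\<^sub>R b i)"
      by (simp add: T_def frame_combine_def scaleR_diff_left sum_subtractf scaleR_diff_right)
    then have "dist (T z) (T z') = (1 / (2 * real N)) * norm (\<Sum>i\<le>d. (z i - z' i) *\<^sub>R b i)"
      by (simp add: dist_norm)
    also have "norm (\<Sum>i\<le>d. (z i - z' i) *\<^sub>R b i) \<le> (\<Sum>i\<le>d. norm ((z i - z' i) *\<^sub>R b i))"
      by (rule norm_sum)
    also have "\<dots> \<le> (\<Sum>i\<le>d. 2)"
    proof (rule sum_mono)
      fix i assume i: "i \<in> {..d}"
      then have "b i \<bullet> b i = 1" using b by (simp add: orthonormal_frame_def)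
      then have "norm (b i) = 1" by (simp add: norm_eq_1)
      then show "norm ((z i - z' i) *\<^sub>R b i) \<le> 2" using zz[of i] by simp
    qed
    finally show ?thesis using \<open>0 < N\<close> by (simp add: mult_left_mono field_simps)
  qed
  define U where "U q = {w \<in> W. \<exists>z\<in>cell q. T z \<in> A w}" for q
  define D where "D q = {y \<in> signed_labels m. \<exists>z\<in>cell q. T z \<in> dominant_region F m y}" for q
  define p where "p w y i = label_sign y *
    (if i < d - 1 then x w (y div 2) \<bullet> e i else if i = d - 1 then 1 else 0)" for w y i
  have center: "(\<lambda>i. real_of_int (q i)) \<in> cell q" for q by (simp add: cell_def)
  have "\<exists>q B y c. q \<in> cube_cells d N \<and> is_facet K B \<and>
    (\<forall>w\<in>B. w \<in> U q \<and> y w \<in> D q \<and> (0::real) \<le> c w) \<and>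
    (\<Sum>w\<in>B. c w) = 1 \<and> (\<forall>i. (\<Sum>w\<in>B. c w * p w (y w) i) = 0)"
  proof (rule facet_of_balanced_labels[OF b \<open>0 < N\<close> W adm finite_signed_labels, of m U D p])
    show "flip ` signed_labels m \<subseteq> signed_labels m" by (auto simp: signed_labels_def)
    show "U q \<in> L" if q: "q \<in> cube_cells d N" for q
    proof -
      let ?z = "\<lambda>i. real_of_int (q i)"
      have "?z \<in> cube_boundary d N" using cell_subset_cube_boundary[OF q] center by blast
      then have "{w \<in> W. T ?z \<in> A w} \<in> L" by (intro A_in_L T0)
      moreover have "{w \<in> W. T ?z \<in> A w} \<subseteq> U q" using center by (auto simp: U_def)
      ultimately show ?thesis
        by (rule admissible_selection_structureD(4)[OF adm]) (auto simp: U_def)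
    qed
    show "D q \<noteq> {} \<and> D q \<subseteq> signed_labels m" for q
    proof -
      obtain y where "y \<in> signed_labels m" "T (\<lambda>i. real_of_int (q i)) \<in> dominant_region F m y"
        using dominant_region_cover[OF \<open>0 < m\<close>, of "T (\<lambda>i. real_of_int (q i))" F] by (elim bexE)
      then have "y \<in> D q" using center by (auto simp: D_def)
      then show ?thesis by (auto simp: D_def)
    qed
    show "U (carrier_cell z) \<subseteq> U q" "D (carrier_cell z) \<subseteq> D q" if "z \<in> cell q" for q z
      using cell_carrier_subset[OF that] by (auto simp: U_def D_def)
    show "U q \<subseteq> U (\<lambda>i. - q i)" for q
    proof
      fix w assume "w \<in> U q"
      then obtain z where z: "w \<in> W" "z \<in> cell q" "T z \<in> A w" by (auto simp: U_def)
      then have "(\<lambda>i. - z i) \<in> cell (\<lambda>i. - q i)" "T (\<lambda>i. - z i) \<in> A w"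
        using A by (simp_all add: cell_minus T_minus)
      then show "w \<in> U (\<lambda>i. - q i)" using z(1) unfolding U_def by blast
    qed
    show "flip ` D q \<subseteq> D (\<lambda>i. - q i)" if q: "q \<in> cube_cells d N" for q
    proof
      fix y assume "y \<in> flip ` D q"
      then obtain y' z where y: "y = flip y'" "y' \<in> signed_labels m" "z \<in> cell q"
        "T z \<in> dominant_region F m y'" by (auto simp: D_def)
      have z: "T z \<noteq> 0" using y(3) cell_subset_cube_boundary[OF q] by (intro T0) blast
      have "T (\<lambda>i. - z i) \<in> dominant_region F m y"
        using y(2,4) F[OF _ z] by (simp add: dominant_region_def T_minus y(1) signed_labels_def)
      moreover have "(\<lambda>i. - z i) \<in> cell (\<lambda>i. - q i)" using y(3) by (simp add: cell_minus)
      moreover have "y \<in> signed_labels m" using y(1,2) by (simp add: signed_labels_def)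
      ultimately show "y \<in> D (\<lambda>i. - q i)" unfolding D_def by blast
    qed
    show "p w (flip y) i = - p w y i" for w y i by (simp add: p_def)
    show "p w y i = 0" if "i \<ge> d" for w y i
    proof -
      have "\<not> i < d - 1" "i \<noteq> d - 1" using that d by linarith+
      then show ?thesis by (simp add: p_def)
    qed
  qed
  then obtain q B y c where q: "q \<in> cube_cells d N" "is_facet K B"
    and yc: "\<forall>w\<in>B. w \<in> U q \<and> y w \<in> D q \<and> (0::real) \<le> c w"
    and c1: "(\<Sum>w\<in>B. c w) = 1" and c0: "\<forall>i. (\<Sum>w\<in>B. c w * p w (y w) i) = 0"
    by (elim exE conjE) (rule that)
  have BW: "B \<subseteq> W" using yc by (auto simp: U_def)
  have yB: "y w \<in> signed_labels m" if "w \<in> B" for w using yc that by (auto simp: D_def)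
  have "balanced_labels x B y"
    unfolding balanced_labels_def
  proof (intro exI[of _ c] conjI)
    show "\<forall>w\<in>B. 0 \<le> c w" using yc by blast
    show "(\<Sum>w\<in>B. c w) = 1" by (rule c1)
    show "(\<Sum>w\<in>B. c w * label_sign (y w)) = 0" using c0[rule_format, of "d - 1"] by (simp add: p_def)
    let ?s = "\<Sum>w\<in>B. (c w * label_sign (y w)) *\<^sub>R x w (y w div 2)"
    show "?s = 0"
    proof (rule e[rule_format])
      show "?s \<in> V"
        using BW yB x by (intro subspace_sum[OF V(1)] subspace_scale[OF V(1)]) (auto simp: signed_labels_def)
      show "?s \<bullet> e i = 0" if "i < d - 1" for i
        using c0[rule_format, of i] that by (simp add: p_def inner_sum_left mult.assoc)
    qed
  qed
  moreover define z0 where "z0 = (\<lambda>i. real_of_int (q i))"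
  have z0: "z0 \<in> cell q" unfolding z0_def by (rule center)
  have X: "T z \<in> X" if "z \<in> cell q" for z using that cell_subset_cube_boundary[OF q(1)] by (intro TX) blast
  have "(\<exists>u\<in>X \<inter> A w. dist u (T z0) \<le> real (d + 1) / real N) \<and>
      (\<exists>u\<in>X \<inter> dominant_region F m (y w). dist u (T z0) \<le> real (d + 1) / real N)" if w: "w \<in> B" for w
  proof -
    obtain z z' where "z \<in> cell q" "T z \<in> A w" "z' \<in> cell q" "T z' \<in> dominant_region F m (y w)"
      using yc w by (auto simp: U_def D_def)
    then show ?thesis using X T_close[OF _ z0] by blast
  qed
  ultimately show ?thesis
    using q(2) yB X[OF z0] by (intro exI[of _ B] exI[of _ y] exI[of _ "T z0"]) auto
qed

section \<open>Existence of a balanced facet\<close>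

text \<open>By definition of the quotient topology, the unit parameters of members of \<open>\<G>\<close> form a closed set. At a limit point
\<open>p\<close> with \<open>fst p \<noteq> 0\<close> the normalization to unit parameters is continuous, and limit points with \<open>fst p = 0\<close> belong to
the set in any case. Excluding a neighbourhood of the origin is essential, as parameters tending to \<open>0\<close> carry no information about
a limiting hyperplane.\<close>

lemma closed_shell_hyperplanes:
  fixes \<G> :: "'a::euclidean_space set set"
  assumes \<G>: "closedin hyperplane_topology \<G>" and X: "closed X" "0 \<notin> X"
  shows "closed (X \<inter> {p. p \<noteq> 0 \<and> (fst p = 0 \<or> hyperplane_of p \<in> \<G>)})"
    (is "closed (X \<inter> ?G)")
proof -
  let ?S = "sphere (0::'a) 1 \<times> (UNIV :: real set)"
  let ?pre = "{p \<in> topspace (top_of_set ?S). hyperplane_of p \<in> \<G>}"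
  have "closedin (top_of_set ?S) ?pre"
    using \<G> by (rule closedin_continuous_map_preimage[OF quotient_imp_continuous_map[OF quotient_map_hyperplane_of]])
  moreover have "closed ?S" by (intro closed_Times) auto
  ultimately have closed_pre: "closed ?pre" by (rule closedin_closed_trans)
  have scale: "hyperplane_of (fst p /\<^sub>R norm (fst p), snd p / norm (fst p)) = hyperplane_of p"
    if "fst p \<noteq> 0" for p :: "'a \<times> real"
    using that by (auto simp: hyperplane_of_def field_simps)
  show ?thesis
    unfolding closed_sequential_limits
  proof (intro allI impI, elim conjE)
    fix P p
    assume P: "\<forall>k. P k \<in> X \<inter> ?G" and lim: "P \<longlonglongrightarrow> p"
    have "\<And>k. P k \<in> X" using P by blast
    then have "p \<in> X" using closed_sequentially[OF X(1) _ lim] by blast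
    then have "p \<noteq> 0" using X(2) by blast
    moreover have "hyperplane_of p \<in> \<G>" if p0: "fst p \<noteq> 0"
    proof -
      have lim1: "(\<lambda>k. fst (P k)) \<longlonglongrightarrow> fst p" by (intro tendsto_intros lim)
      have ev: "\<forall>\<^sub>F k in sequentially. fst (P k) \<noteq> 0"
        using lim1 p0 by (rule tendsto_imp_eventually_ne)
      define f where "f k = (fst (P k) /\<^sub>R norm (fst (P k)), snd (P k) / norm (fst (P k)))" for k
      have "f \<longlonglongrightarrow> (fst p /\<^sub>R norm (fst p), snd p / norm (fst p))"
        unfolding f_def using p0 by (intro tendsto_intros lim) auto
      moreover have "\<forall>\<^sub>F k in sequentially. f k \<in> ?pre"
        using ev
      proof eventually_elim
        case (elim k)
        have "P k \<in> ?G" using P by blast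
        then have "hyperplane_of (P k) \<in> \<G>" using elim by simp
        then show ?case using elim by (simp add: f_def scale)
      qed
      ultimately have "(fst p /\<^sub>R norm (fst p), snd p / norm (fst p)) \<in> ?pre"
        by (intro Lim_in_closed_set[OF closed_pre]) auto
      then show ?thesis using scale[OF p0] by simp
    qed
    ultimately show "p \<in> X \<inter> ?G" using \<open>p \<in> X\<close> by blast
  qed
qed

lemma closed_shell_dominant_region:
  fixes F :: "nat \<Rightarrow> 'e::topological_space \<Rightarrow> real"
  assumes "closed X" "\<And>i. i \<in> {1..m} \<Longrightarrow> continuous_on X (F i)" "y \<in> signed_labels m"
  shows "closed (X \<inter> dominant_region F m y)"
proof -
  have j: "y div 2 \<in> {1..m}" using assms(3) by (simp add: signed_labels_def)
  then have "X \<inter> dominant_region F m y = (\<Inter>i\<in>{1..m}. {p \<in> X. \<bar>F i p\<bar> \<le> label_sign y * F (y div 2) p})"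
    by (auto simp: dominant_region_def)
  moreover have "closed {p \<in> X. \<bar>F i p\<bar> \<le> label_sign y * F (y div 2) p}" if "i \<in> {1..m}" for i
    by (intro continuous_on_closed_Collect_le continuous_intros assms(1) assms(2)[OF that] assms(2)[OF j])
  then have "closed (\<Inter>i\<in>{1..m}. {p \<in> X. \<bar>F i p\<bar> \<le> label_sign y * F (y div 2) p})"
    by (intro closed_INT ballI)
  ultimately show ?thesis by (simp only:)
qed

lemma balanced_labels_restrict: "balanced_labels x B (restrict y B) = balanced_labels x B y"
proof -
  have "(\<Sum>w\<in>B. c w * label_sign (restrict y B w)) = (\<Sum>w\<in>B. c w * label_sign (y w))"
    "(\<Sum>w\<in>B. (c w * label_sign (restrict y B w)) *\<^sub>R x w (restrict y B w div 2)) =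
     (\<Sum>w\<in>B. (c w * label_sign (y w)) *\<^sub>R x w (y w div 2))" for c
    by (auto intro!: sum.cong)
  then show ?thesis unfolding balanced_labels_def by (simp only:)
qed

theorem theorem7:
  fixes m d :: nat
    and W :: "'w set" and K L :: "'w set set"
    and V :: "'b::euclidean_space set" and x :: "'w \<Rightarrow> nat \<Rightarrow> 'b"
    and \<mu> :: "nat \<Rightarrow> (real ^ 'n) measure"
    and G :: "'w \<Rightarrow> (real ^ 'n) set set"
  assumes "0 < m" and "d = CARD('n)"
    and "finite W"
    and "admissible_selection_structure d W K L"
    \<comment> \<open>\<open>V\<close> plays the role of \<open>(d-1)\<close>-dimensional Euclidean space. A subspace is used because
      \<open>d - 1\<close> may be \<open>0\<close>, which is not the dimension of any Euclidean space type.\<close>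
    and "subspace V" and "dim V = d - 1"
    and "\<And>w i. w \<in> W \<Longrightarrow> i \<in> {1..m} \<Longrightarrow> x w i \<in> V"
    and "\<And>i. i \<in> {1..m} \<Longrightarrow> prob_space (\<mu> i)"
    and "\<And>i. i \<in> {1..m} \<Longrightarrow> sets (\<mu> i) = sets borel"
    and "\<And>i. i \<in> {1..m} \<Longrightarrow> absolutely_continuous lborel (\<mu> i)"
    and "\<not> (\<exists>H. is_hyperplane H \<and> (\<forall>i\<in>{1..m}. bisects H (\<mu> i)))"
    and "\<And>w. w \<in> W \<Longrightarrow> closedin hyperplane_topology (G w)"
    and "\<And>W' H. W' \<subseteq> W \<Longrightarrow> W - W' \<notin> L \<Longrightarrow> is_hyperplane H \<Longrightarrow> H \<in> (\<Union>w\<in>W'. G w)"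
  shows "\<exists>Hp B f. is_closed_halfspace Hp \<and> is_facet K B \<and> frontier Hp \<in> (\<Inter>w\<in>B. G w) \<and>
    f \<in> B \<rightarrow> {1..m} \<and>
    (\<forall>w\<in>B. \<bar>measure (\<mu> (f w)) Hp - 1/2\<bar> = Max ((\<lambda>j. \<bar>measure (\<mu> j) Hp - 1/2\<bar>) ` {1..m})) \<and>
    (let P\<^sub>p = {w \<in> B. measure (\<mu> (f w)) Hp - 1/2 > 0};
         P\<^sub>m = {w \<in> B. measure (\<mu> (f w)) Hp - 1/2 < 0}
     in f ` P\<^sub>p \<inter> f ` P\<^sub>m = {} \<and>
        convex hull ((\<lambda>w. x w (f w)) ` P\<^sub>p) \<inter> convex hull ((\<lambda>w. x w (f w)) ` P\<^sub>m) \<noteq> {})"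
proof -
  note m = assms(1) and dn = assms(2) and W = assms(3) and adm = assms(4) and V = assms(5,6)
    and xV = assms(7) and prob = assms(8) and sets_\<mu> = assms(9) and ac = assms(10)
    and no_bisection = assms(11) and G_closed = assms(12) and G_cover = assms(13)
  define F where "F i = excess (\<mu> i)" for i
  define X :: "((real ^ 'n) \<times> real) set" where "X = {p. 1 \<le> norm p \<and> norm p \<le> real (d + 1)}"
  \<comment> \<open>Parameters with \<open>fst p = 0\<close> describe no hyperplane and are admitted for every \<open>w\<close>; they are ruled out for the limit below.\<close>
  define A where "A w = {p. p \<noteq> 0 \<and> (fst p = 0 \<or> hyperplane_of p \<in> G w)}" for w
  have X_eq: "X = cball 0 (real (d + 1)) - ball 0 1" by (auto simp: X_def)
  have "compact X" unfolding X_eq by (rule compact_diff[OF compact_cball open_ball])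
  then have X: "compact X" "closed X" "0 \<notin> X" by (auto simp: X_def compact_imp_closed)
  have F_minus: "F i (- p) = - F i p" if "i \<in> {1..m}" "p \<noteq> 0" for i p
    unfolding F_def using that by (intro excess_minus prob sets_\<mu> ac)
  have F_cont: "continuous_on X (F i)" if "i \<in> {1..m}" for i
    unfolding F_def
    by (rule continuous_on_subset[OF continuous_excess[OF prob[OF that] sets_\<mu>[OF that] ac[OF that]]])
      (use X(3) in blast)
  have F_nonzero: "\<exists>i\<in>{1..m}. F i p \<noteq> 0" if p: "p \<noteq> 0" for p
  proof (cases "fst p = 0")
    case True
    have one: "1 \<in> {1..m}" using m by simp
    have "F 1 p \<noteq> 0"
      using excess_vertical[OF prob[OF one] sets_\<mu>[OF one] True p] by (simp add: F_def)
    then show ?thesis using one by blast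
  next
    case False
    show ?thesis
    proof (rule ccontr)
      assume "\<not> ?thesis"
      then have F0: "F i p = 0" if "i \<in> {1..m}" for i using that by blast
      have "bisects (hyperplane_of p) (\<mu> i)" if i: "i \<in> {1..m}" for i
        unfolding bisects_def
      proof (intro exI conjI)
        show "fst p \<noteq> 0" by (rule False)
        show "hyperplane_of p = {x. fst p \<bullet> x = snd p}" by (simp add: hyperplane_of_def)
        have "F i p = 0" "F i (- p) = 0" using F0[OF i] F_minus[OF i p] by simp_all
        then show "measure (\<mu> i) {x. snd p \<le> fst p \<bullet> x} = measure (\<mu> i) {x. fst p \<bullet> x \<le> snd p}"
          by (simp add: F_def excess_def)
      qed
      moreover have "is_hyperplane (hyperplane_of p)"
        using False by (auto simp: is_hyperplane_def hyperplane_of_def)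
      ultimately show False using no_bisection by blast
    qed
  qed
  have A_minus: "- p \<in> A w" if "p \<in> A w" for p w
  proof -
    have "hyperplane_of (- p) = hyperplane_of p" by (simp add: hyperplane_of_def)
    then show ?thesis using that by (simp add: A_def)
  qed
  \<comment> \<open>If \<open>fst p = 0\<close> then every \<open>w\<close> qualifies, and \<open>W\<close> is a member of \<open>L\<close> because \<open>L\<close> is nonempty and upward closed.\<close>
  have A_in_L: "{w \<in> W. p \<in> A w} \<in> L" if p: "p \<noteq> 0" for p
  proof (cases "fst p = 0")
    case True
    obtain U where "U \<in> L" using admissible_selection_structureD(3)[OF adm] by blast
    then have "W \<in> L"
      using admissible_selection_structureD(4)[OF adm \<open>U \<in> L\<close>, of W]
        admissible_selection_structureD(5)[OF adm \<open>U \<in> L\<close>] by blast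
    then show ?thesis using p True by (simp add: A_def)
  next
    case False
    let ?W' = "W - {w \<in> W. p \<in> A w}"
    show ?thesis
    proof (rule ccontr)
      assume "\<not> ?thesis"
      moreover have "W - ?W' = {w \<in> W. p \<in> A w}" by blast
      ultimately have "W - ?W' \<notin> L" by simp
      moreover have "is_hyperplane (hyperplane_of p)"
        using False by (auto simp: is_hyperplane_def hyperplane_of_def)
      ultimately have "hyperplane_of p \<in> (\<Union>w\<in>?W'. G w)" by (intro G_cover) auto
      then show False using p by (auto simp: A_def)
    qed
  qed
  \<comment> \<open>Labellings are taken to be extensional, so that only finitely many candidates have to be considered.\<close>
  define P where "P = {(B, y). is_facet K B \<and> y \<in> B \<rightarrow>\<^sub>E signed_labels m \<and> balanced_labels x B y}"
  define \<S> where "\<S> = (\<lambda>(B, y). (\<lambda>w. X \<inter> A w) ` B \<union> (\<lambda>w. X \<inter> dominant_region F m (y w)) ` B)"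
  have facet_W: "B \<subseteq> W" if "is_facet K B" for B
    using that admissible_selection_structureD(2)[OF adm] by (auto simp: is_facet_def)
  have "finite P"
  proof (rule finite_subset)
    show "P \<subseteq> Sigma (Pow W) (\<lambda>B. B \<rightarrow>\<^sub>E signed_labels m)"
      using facet_W by (auto simp: P_def)
    have "finite (B \<rightarrow>\<^sub>E signed_labels m)" if "B \<in> Pow W" for B
      using that W finite_subset by (intro finite_PiE finite_signed_labels) auto
    then show "finite (Sigma (Pow W) (\<lambda>B. B \<rightarrow>\<^sub>E signed_labels m))"
      using W by (intro finite_SigmaI) simp_all
  qed
  have closed_\<S>: "closed s" if \<pi>: "\<pi> \<in> P" and s: "s \<in> \<S> \<pi>" for \<pi> s
  proof -
    obtain B y where [simp]: "\<pi> = (B, y)" by (cases \<pi>)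
    have B: "B \<subseteq> W" "\<And>w. w \<in> B \<Longrightarrow> y w \<in> signed_labels m"
      using \<pi> facet_W by (auto simp: P_def)
    consider w where "w \<in> B" "s = X \<inter> A w" | w where "w \<in> B" "s = X \<inter> dominant_region F m (y w)"
      using s by (auto simp: \<S>_def)
    then show ?thesis
    proof cases
      case 1
      then have "closedin hyperplane_topology (G w)" using B(1) by (intro G_closed) blast
      then show ?thesis unfolding 1(2) A_def by (rule closed_shell_hyperplanes[OF _ X(2,3)])
    next
      case 2
      then show ?thesis by (simp only:) (intro closed_shell_dominant_region X(2) F_cont B(2))
    qed
  qed
  have near: "\<exists>\<pi>\<in>P. \<exists>p\<in>X. \<forall>s\<in>\<S> \<pi>. \<exists>u\<in>s. dist u p \<le> real (d + 1) / real N" if N: "N > 0" for N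
  proof -
    have dim: "DIM((real ^ 'n) \<times> real) = Suc d" using dn by simp
    have "\<exists>B y p. is_facet K B \<and> y \<in> B \<rightarrow> signed_labels m \<and> balanced_labels x B y \<and> p \<in> X \<and>
      (\<forall>w\<in>B. (\<exists>u\<in>X \<inter> A w. dist u p \<le> real (d + 1) / real N) \<and>
           (\<exists>u\<in>X \<inter> dominant_region F m (y w). dist u p \<le> real (d + 1) / real N))"
    proof (rule approximate_solution[where F = F and A = A, OF dim m N W adm V _ _ _ _ X_def])
      show "x w i \<in> V" if "w \<in> W" "i \<in> {1..m}" for w i using that by (rule xV)
      show "F i (- p) = - F i p" if "i \<in> {1..m}" "p \<noteq> 0" for i p using that by (rule F_minus)
      show "- p \<in> A w" if "p \<in> A w" for w p using that by (rule A_minus)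
      show "{w \<in> W. p \<in> A w} \<in> L" if "p \<noteq> 0" for p using that by (rule A_in_L)
    qed
    then obtain B y p where B: "is_facet K B" "y \<in> B \<rightarrow> signed_labels m" "balanced_labels x B y" "p \<in> X"
      "\<forall>w\<in>B. (\<exists>u\<in>X \<inter> A w. dist u p \<le> real (d + 1) / real N) \<and>
           (\<exists>u\<in>X \<inter> dominant_region F m (y w). dist u p \<le> real (d + 1) / real N)"
      by (elim exE conjE) (rule that)
    have "(B, restrict y B) \<in> P" using B(1-3) by (auto simp: P_def balanced_labels_restrict)
    moreover have "\<forall>s\<in>\<S> (B, restrict y B). \<exists>u\<in>s. dist u p \<le> real (d + 1) / real N"
      using B(5) by (auto simp: \<S>_def)
    ultimately show ?thesis using B(4) by blast
  qed
  have "\<exists>\<pi>\<in>P. \<exists>p\<in>X. \<forall>s\<in>\<S> \<pi>. p \<in> s"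
  proof (rule common_point_of_nearly_meeting_closed_sets[where c = "real (d + 1)", OF X(1) \<open>finite P\<close>])
    show "\<forall>\<pi>\<in>P. \<forall>s\<in>\<S> \<pi>. closed s" by (intro ballI closed_\<S>)
    show "\<forall>N>0. \<exists>\<pi>\<in>P. \<exists>p\<in>X. \<forall>s\<in>\<S> \<pi>. \<exists>u\<in>s. dist u p \<le> real (d + 1) / real N"
      by (intro allI impI near)
  qed
  then obtain \<pi> p where \<pi>: "\<pi> \<in> P" "p \<in> X" "\<forall>s\<in>\<S> \<pi>. p \<in> s" by (elim bexE)
  obtain B y where By: "\<pi> = (B, y)" by (cases \<pi>)
  have facet: "is_facet K B" and y: "\<And>w. w \<in> B \<Longrightarrow> y w \<in> signed_labels m" and bal: "balanced_labels x B y"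
    using \<pi>(1) by (auto simp: P_def By)
  have finB: "finite B" using facet_W[OF facet] W by (rule finite_subset)
  have p0: "p \<noteq> 0" using \<pi>(2) X(3) by blast
  have pG: "p \<in> A w" and dom: "p \<in> dominant_region F m (y w)" if "w \<in> B" for w
    using \<pi>(3) that by (auto simp: \<S>_def By)
  define f where "f w = y w div 2" for w
  have f: "f w \<in> {1..m}" if "w \<in> B" for w using y[OF that] by (simp add: f_def signed_labels_def)
  have val: "\<bar>F i p\<bar> \<le> label_sign (y w) * F (f w) p" if "w \<in> B" "i \<in> {1..m}" for i w
    using dom[OF that(1)] that(2) by (simp add: dominant_region_def f_def)
  have pos: "0 < label_sign (y w) * F (f w) p" if "w \<in> B" for w
  proof -
    obtain i where i: "i \<in> {1..m}" "F i p \<noteq> 0" using F_nonzero[OF p0] by blast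
    then show ?thesis using val[OF that i(1)] by linarith
  qed
  have sgn: "label_sign (y w) = 1 \<and> 0 < F (f w) p \<or> label_sign (y w) = - 1 \<and> F (f w) p < 0"
    if "w \<in> B" for w
    using pos[OF that] by (auto simp: label_sign_def split: if_splits)
  obtain c where c: "\<forall>w\<in>B. 0 \<le> c w" "(\<Sum>w\<in>B. c w) = 1" "(\<Sum>w\<in>B. c w * label_sign (y w)) = 0"
    "(\<Sum>w\<in>B. (c w * label_sign (y w)) *\<^sub>R x w (f w)) = 0"
    using bal unfolding balanced_labels_def f_def by blast
  \<comment> \<open>For \<open>fst p = 0\<close> all labels would carry the same sign and could not be balanced.\<close>
  have a0: "fst p \<noteq> 0"
  proof
    assume vert: "fst p = 0"
    define \<delta> :: real where "\<delta> = (if snd p < 0 then 1 else - 1)"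
    have "label_sign (y w) = \<delta>" if w: "w \<in> B" for w
    proof -
      have "F (f w) p = (if snd p < 0 then 1/2 else - 1/2)"
        unfolding F_def by (intro excess_vertical prob sets_\<mu> f w vert p0)
      then show ?thesis using sgn[OF w] by (auto simp: \<delta>_def split: if_splits)
    qed
    then have "(\<Sum>w\<in>B. c w * label_sign (y w)) = (\<Sum>w\<in>B. c w * \<delta>)"
      by (intro sum.cong) auto
    also have "\<dots> = (\<Sum>w\<in>B. c w) * \<delta>" by (rule sum_distrib_right[symmetric])
    finally have "\<delta> = 0" unfolding c(2,3) by simp
    then show False by (simp add: \<delta>_def split: if_splits)
  qed
  define Hp where "Hp = {x. snd p \<le> fst p \<bullet> x}"
  have FHp: "measure (\<mu> i) Hp - 1/2 = F i p" for i by (simp add: F_def excess_def Hp_def)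
  have front: "frontier Hp = hyperplane_of p"
    unfolding Hp_def hyperplane_of_def using a0 by (intro frontier_halfspace_ge) simp
  have pp: "{w \<in> B. measure (\<mu> (f w)) Hp - 1/2 > 0} = {w \<in> B. label_sign (y w) = 1}"
    and pm: "{w \<in> B. measure (\<mu> (f w)) Hp - 1/2 < 0} = {w \<in> B. label_sign (y w) = - 1}"
    unfolding FHp using sgn by force+
  show ?thesis
  proof (intro exI conjI)
    show "is_closed_halfspace Hp" using a0 by (auto simp: is_closed_halfspace_def Hp_def)
    show "is_facet K B" by (rule facet)
    show "frontier Hp \<in> (\<Inter>w\<in>B. G w)" using pG a0 by (auto simp: front A_def)
    show "f \<in> B \<rightarrow> {1..m}" using f by blast
    show "\<forall>w\<in>B. \<bar>measure (\<mu> (f w)) Hp - 1/2\<bar> = Max ((\<lambda>j. \<bar>measure (\<mu> j) Hp - 1/2\<bar>) ` {1..m})"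
    proof
      fix w assume w: "w \<in> B"
      have "\<bar>F i p\<bar> \<le> \<bar>F (f w) p\<bar>" if "i \<in> {1..m}" for i
        using val[OF w that] sgn[OF w] by auto
      then have "Max ((\<lambda>j. \<bar>F j p\<bar>) ` {1..m}) = \<bar>F (f w) p\<bar>"
        using f[OF w] by (intro Max_eqI) auto
      then show "\<bar>measure (\<mu> (f w)) Hp - 1/2\<bar> = Max ((\<lambda>j. \<bar>measure (\<mu> j) Hp - 1/2\<bar>) ` {1..m})"
        unfolding FHp by simp
    qed
    have "convex hull ((\<lambda>w. x w (f w)) ` {w \<in> B. label_sign (y w) = 1}) \<inter>
        convex hull ((\<lambda>w. x w (f w)) ` {w \<in> B. label_sign (y w) = - 1}) \<noteq> {}"
      using c by (intro balanced_signs_hulls_meet[OF finB, of c]) (auto simp: label_sign_def)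
    moreover have "f ` {w \<in> B. label_sign (y w) = 1} \<inter> f ` {w \<in> B. label_sign (y w) = - 1} = {}"
    proof -
      have False if "w \<in> B" "label_sign (y w) = 1" "w' \<in> B" "label_sign (y w') = - 1" "f w = f w'" for w w'
        using sgn[OF that(1)] sgn[OF that(3)] that by simp
      then show ?thesis by blast
    qed
    ultimately show "let P\<^sub>p = {w \<in> B. measure (\<mu> (f w)) Hp - 1/2 > 0};
        P\<^sub>m = {w \<in> B. measure (\<mu> (f w)) Hp - 1/2 < 0}
      in f ` P\<^sub>p \<inter> f ` P\<^sub>m = {} \<and>
        convex hull ((\<lambda>w. x w (f w)) ` P\<^sub>p) \<inter> convex hull ((\<lambda>w. x w (f w)) ` P\<^sub>m) \<noteq> {}"
      unfolding Let_def pp pm by blast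
  qed
qed

end
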